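(* Every graph in $\overline{\mathcal W}$ is pre-partitionable. In particular, every graph in $\overline{\mathcal W}$ has an unfriendly partition.
   Context: For a graph $G$, let $V_\infty(G)$ be the set of vertices of infinite degree and let $V^*(G)$ be the set of vertices in $V_\infty(G)$ having only finitely many neighbours in $V_\infty(G)$. Let $\mathcal W$ be the class of countable graphs $G$ with $V^*(G)$ finite. For each ordinal $\mu$ define $\mathcal W(\mu)$ recursively: $\mathcal W(0)=\mathcal W$, and for $\mu>0$ a graph $G$ belongs to $\mathcal W(\mu)$ if it has a finite vertex set $S$ such that for every component $C$ of $G-S$ there is an ordinal $\lambda<\mu$ with $C\in\mathcal W(\lambda)$; $\overline{\mathcal W}$ is the union of all $\mathcal W(\lambda)$. A partition of a vertex set $V$ is a function $\pi:V\to\{0,1\}$. For a vertex $x$, a neighbour $y$ is an opponent if $\pi(y)\neq\pi(x)$ and a friend otherwise; $x$ is happy in $\pi$ if the (cardinal) number of its opponents is at least the number of its friends. A partition of $V(G)$ is unfriendly if every vertex is happy. A graph $G$ is pre-partitionable if for every $U\subseteq V(G)$ and every partition $\pi$ of $U$ there is a partition $\pi'$ of $V(G)$ extending $\pi$ such that every vertex of $V(G)\setminus U$ is happy in $\pi'$. *)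

theory Defs
  imports Main "HOL-Library.Countable_Set" "HOL-Library.FuncSet"
begin

unbundle cardinal_syntax

text \<open>Simple graphs, possibly infinite: a vertex set and a set of two-element vertex sets.\<close>

type_synonym 'a ugraph = "'a set \<times> 'a set set"

abbreviation verts :: "'a ugraph \<Rightarrow> 'a set" where "verts G \<equiv> fst G"
abbreviation edges :: "'a ugraph \<Rightarrow> 'a set set" where "edges G \<equiv> snd G"

definition is_graph :: "'a ugraph \<Rightarrow> bool" where
  "is_graph G \<longleftrightarrow> (\<forall>e \<in> edges G. e \<subseteq> verts G \<and> card e = 2)"

definition nbrs :: "'a ugraph \<Rightarrow> 'a \<Rightarrow> 'a set" where
  "nbrs G x = {y \<in> verts G. {x, y} \<in> edges G}"

definition induced :: "'a ugraph \<Rightarrow> 'a set \<Rightarrow> 'a ugraph" where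
  "induced G U = (U, {e \<in> edges G. e \<subseteq> U})"

definition remove_verts :: "'a ugraph \<Rightarrow> 'a set \<Rightarrow> 'a ugraph" where
  "remove_verts G S = induced G (verts G - S)"

definition reachable :: "'a ugraph \<Rightarrow> 'a \<Rightarrow> 'a \<Rightarrow> bool" where
  "reachable G x y \<longleftrightarrow> (x, y) \<in> {(u, v). {u, v} \<in> edges G}\<^sup>*"

definition components :: "'a ugraph \<Rightarrow> 'a ugraph set" where
  "components G = {induced G {y \<in> verts G. reachable G x y} | x. x \<in> verts G}"

definition V_inf :: "'a ugraph \<Rightarrow> 'a set" where
  "V_inf G = {x \<in> verts G. infinite (nbrs G x)}"

definition V_star :: "'a ugraph \<Rightarrow> 'a set" where
  "V_star G = {x \<in> V_inf G. finite (nbrs G x \<inter> V_inf G)}"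

definition base_W :: "'a ugraph set" where
  "base_W = {G. is_graph G \<and> countable (verts G) \<and> finite (V_star G)}"

text \<open>
  Ordinals are represented by well-orders (compared by \<open><o\<close>) on a type \<open>'o\<close>; the ordinal zero
  is the empty relation. Every ordinal below \<open>\<mu>\<close> is the order type of an initial segment of
  \<open>\<mu>\<close>, so ranging only over well-orders on the same type \<open>'o\<close> in the second rule loses none
  of them. As \<open><o\<close> is well-founded, the inductive definition coincides with transfinite recursion.
\<close>

inductive in_W :: "'o rel \<Rightarrow> 'a ugraph \<Rightarrow> bool" where
  zero: "G \<in> base_W \<Longrightarrow> in_W {} G"
| pos: "\<lbrakk>Well_order \<mu>; \<mu> \<noteq> {}; is_graph G; finite S; S \<subseteq> verts G;
         \<forall>C \<in> components (remove_verts G S). \<exists>\<nu> :: 'o rel. \<nu> <o \<mu> \<and> in_W \<nu> C\<rbrakk> \<Longrightarrow> in_W \<mu> G"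

lemma in_W_zero_iff: "in_W {} G \<longleftrightarrow> G \<in> base_W"
  by (subst in_W.simps) simp

lemma in_W_pos_iff:
  fixes \<mu> :: "'o rel"
  assumes "Well_order \<mu>" "\<mu> \<noteq> {}"
  shows "in_W \<mu> G \<longleftrightarrow> is_graph G \<and> (\<exists>S. finite S \<and> S \<subseteq> verts G \<and>
    (\<forall>C \<in> components (remove_verts G S). \<exists>\<nu> :: 'o rel. \<nu> <o \<mu> \<and> in_W \<nu> C))"
  by (subst in_W.simps) (simp add: assms)

text \<open>
  The type argument only bounds the ordinals available in the union; a result for all
  types \<open>'o\<close> covers the union over all ordinals.
\<close>

definition W_bar :: "'o itself \<Rightarrow> 'a ugraph set" where
  "W_bar (_ :: 'o itself) = {G. \<exists>\<mu> :: 'o rel. Well_order \<mu> \<and> in_W \<mu> G}"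

definition is_partition :: "'a set \<Rightarrow> ('a \<Rightarrow> nat) \<Rightarrow> bool" where
  "is_partition U \<pi> \<longleftrightarrow> \<pi> \<in> U \<rightarrow> {0, 1}"

definition opponents :: "'a ugraph \<Rightarrow> ('a \<Rightarrow> nat) \<Rightarrow> 'a \<Rightarrow> 'a set" where
  "opponents G \<pi> x = {y \<in> nbrs G x. \<pi> y \<noteq> \<pi> x}"

definition friends :: "'a ugraph \<Rightarrow> ('a \<Rightarrow> nat) \<Rightarrow> 'a \<Rightarrow> 'a set" where
  "friends G \<pi> x = {y \<in> nbrs G x. \<pi> y = \<pi> x}"

definition happy :: "'a ugraph \<Rightarrow> ('a \<Rightarrow> nat) \<Rightarrow> 'a \<Rightarrow> bool" where
  "happy G \<pi> x \<longleftrightarrow> |friends G \<pi> x| \<le>o |opponents G \<pi> x|"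

definition unfriendly :: "'a ugraph \<Rightarrow> ('a \<Rightarrow> nat) \<Rightarrow> bool" where
  "unfriendly G \<pi> \<longleftrightarrow> is_partition (verts G) \<pi> \<and> (\<forall>x \<in> verts G. happy G \<pi> x)"

definition pre_partitionable :: "'a ugraph \<Rightarrow> bool" where
  "pre_partitionable G \<longleftrightarrow>
     (\<forall>U \<pi>. U \<subseteq> verts G \<and> is_partition U \<pi> \<longrightarrow>
        (\<exists>\<pi>'. is_partition (verts G) \<pi>' \<and> (\<forall>x \<in> U. \<pi>' x = \<pi> x) \<and>
              (\<forall>x \<in> verts G - U. happy G \<pi>' x)))"

end

theory Submission
  imports Defs
begin

text \<open>
  Call a colouring good if every vertex of infinite degree outside the precoloured set is happy and no
  recolouring of finitely many free vertices of finite degree lowers the number of monochromatic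
  edges. Suppose a precoloured vertex \<open>x\<close> with set of opponents \<open>O\<close> changes its colour. The
  invariant carried through the induction is that a good colouring can be restored by changing
  only finitely many vertices if \<open>O\<close> is finite, and at most \<open>|O|\<close> vertices otherwise. For finite
  \<open>O\<close> this always holds: the number of monochromatic edges that a finite recolouring can save
  after the flip is at most \<open>2 |O|\<close>, so an optimal one exists.

  The invariant allows a single vertex \<open>t\<close> of infinite degree to be released from the
  precolouring: if \<open>t\<close> is unhappy, it has fewer opponents than neighbours. Flip it: the
  repair changes fewer vertices than \<open>t\<close> has neighbours, and \<open>t\<close> ends up happy. This is
  insensitive to the cofinality of the degree. In the induction step, the separator is precoloured,
  the components are treated independently, and the separator is then released vertex by vertex.
  In the countable base case the vertices with infinitely many neighbours of infinite degree
  receive, greedily, colours that keep them happy whatever happens elsewhere; the vertices of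
  finite degree are coloured by compactness, and the finitely many others are released.
\<close>

section \<open>Counting monochromatic edges\<close>

text \<open>Colours are Booleans, so that a flip is a negation, and colourings are total functions
  whose values off \<open>verts G\<close> carry no meaning.\<close>

definition opp :: "'a ugraph \<Rightarrow> ('a \<Rightarrow> bool) \<Rightarrow> 'a \<Rightarrow> 'a set" where
  "opp G c x = {y \<in> nbrs G x. c y \<noteq> c x}"

definition fin_verts :: "'a ugraph \<Rightarrow> 'a set" where
  "fin_verts G = {x \<in> verts G. finite (nbrs G x)}"

text \<open>Restricting to edges that meet \<open>D\<close> keeps the count finite when
  \<open>D\<close> is a finite set of vertices of finite degree, and a recolouring of
  \<open>D\<close> affects no other edges.\<close>

definition mono_at :: "'a ugraph \<Rightarrow> ('a \<Rightarrow> bool) \<Rightarrow> 'a set \<Rightarrow> 'a set set" where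
  "mono_at G c D = {e \<in> edges G. e \<inter> D \<noteq> {} \<and> (\<exists>b. \<forall>v\<in>e. c v = b)}"

text \<open>Meant for \<open>F \<subseteq> fin_verts G\<close>; elsewhere \<open>mono_at\<close> may be infinite and \<open>card\<close> is the junk value 0.\<close>

definition near_min :: "'a ugraph \<Rightarrow> 'a set \<Rightarrow> nat \<Rightarrow> ('a \<Rightarrow> bool) \<Rightarrow> bool" where
  "near_min G F k c \<longleftrightarrow>
     (\<forall>D c'. finite D \<and> D \<subseteq> F \<and> (\<forall>v. v \<notin> D \<longrightarrow> c' v = c v) \<longrightarrow>
        card (mono_at G c D) \<le> card (mono_at G c' D) + k)"

lemma near_minD:
  assumes "near_min G F k c" "finite D" "D \<subseteq> F" "\<And>v. v \<notin> D \<Longrightarrow> c' v = c v"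
  shows "card (mono_at G c D) \<le> card (mono_at G c' D) + k"
  using assms unfolding near_min_def by blast

lemma near_min_antimono: "near_min G F k c \<Longrightarrow> F' \<subseteq> F \<Longrightarrow> near_min G F' k c"
  using order_trans[of _ F' F] unfolding near_min_def by auto

lemma edge_at_vertex:
  assumes "is_graph G" "e \<in> edges G" "x \<in> e"
  shows "\<exists>y\<in>nbrs G x. e = {x, y} \<and> y \<noteq> x"
proof -
  have "card e = 2" "e \<subseteq> verts G" using assms unfolding is_graph_def by auto
  then obtain a b where "e = {a, b}" "a \<noteq> b" by (meson card_2_iff)
  then show ?thesis using assms \<open>e \<subseteq> verts G\<close> unfolding nbrs_def
    by (auto simp: insert_commute)
qed

lemma nbrs_neq: "is_graph G \<Longrightarrow> y \<in> nbrs G x \<Longrightarrow> y \<noteq> x"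
  unfolding is_graph_def nbrs_def by fastforce

lemma finite_mono_at:
  assumes "is_graph G" "finite D" "D \<subseteq> fin_verts G"
  shows "finite (mono_at G c D)"
proof (rule finite_subset)
  show "mono_at G c D \<subseteq> (\<Union>d\<in>D. (\<lambda>y. {d, y}) ` nbrs G d)"
    using edge_at_vertex[OF assms(1)] unfolding mono_at_def by fast
  show "finite (\<Union>d\<in>D. (\<lambda>y. {d, y}) ` nbrs G d)"
    using assms unfolding fin_verts_def by auto
qed

lemma mono_at_cong:
  assumes "is_graph G" "\<And>v. v \<in> D \<union> (\<Union>d\<in>D. nbrs G d) \<Longrightarrow> c v = c' v"
  shows "mono_at G c D = mono_at G c' D"
proof -
  have "c v = c' v" if "e \<in> edges G" "e \<inter> D \<noteq> {}" "v \<in> e" for e v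
    using edge_at_vertex[OF assms(1) that(1)] that assms(2) by blast
  then show ?thesis unfolding mono_at_def by auto
qed

text \<open>Edges that meet \<open>D'\<close> but avoid \<open>D\<close> look the same to both
  colourings, so the saving on \<open>D'\<close> equals the saving on \<open>D\<close>. The additive
  form avoids truncated subtraction.\<close>

lemma mono_at_exchange:
  assumes G: "is_graph G" and D': "finite D'" "D' \<subseteq> fin_verts G" "D \<subseteq> D'"
    and c: "\<And>v. v \<notin> D \<Longrightarrow> c' v = c v"
  shows "card (mono_at G c D') + card (mono_at G c' D)
       = card (mono_at G c' D') + card (mono_at G c D)"
proof -
  define R where "R = {e \<in> edges G. e \<inter> D' \<noteq> {} \<and> e \<inter> D = {} \<and> (\<exists>b. \<forall>v\<in>e. c v = b)}"
  have R': "R = {e \<in> edges G. e \<inter> D' \<noteq> {} \<and> e \<inter> D = {} \<and> (\<exists>b. \<forall>v\<in>e. c' v = b)}"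
    unfolding R_def using c by (auto simp: disjoint_iff)
  have "mono_at G c D' = mono_at G c D \<union> R" "mono_at G c D \<inter> R = {}"
    using \<open>D \<subseteq> D'\<close> unfolding mono_at_def R_def by auto
  moreover have "mono_at G c' D' = mono_at G c' D \<union> R" "mono_at G c' D \<inter> R = {}"
    using \<open>D \<subseteq> D'\<close> unfolding mono_at_def R' by auto
  moreover have "finite (mono_at G c D')" "finite (mono_at G c' D')"
    using finite_mono_at[OF G] D' by auto
  ultimately show ?thesis by (simp add: card_Un_disjoint)
qed

text \<open>A recolouring that attains the least valid slack is itself unimprovable.\<close>

lemma near_min_improve:
  assumes G: "is_graph G" and F: "F \<subseteq> fin_verts G" and "near_min G F k c"
  shows "\<exists>D c'. finite D \<and> D \<subseteq> F \<and> (\<forall>v. v \<notin> D \<longrightarrow> c' v = c v) \<and> near_min G F 0 c'"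
proof -
  define k0 where "k0 = (LEAST k. near_min G F k c)"
  have k0: "near_min G F k0 c" unfolding k0_def using assms(3) by (rule LeastI)
  show ?thesis
  proof (cases k0)
    case 0
    then show ?thesis using k0 by (intro exI[of _ "{}"] exI[of _ c]) auto
  next
    case (Suc m)
    then have "\<not> near_min G F m c" unfolding k0_def by (metis lessI not_less_Least)
    then obtain D c' where D: "finite D" "D \<subseteq> F" and c': "\<forall>v. v \<notin> D \<longrightarrow> c' v = c v"
      and gt: "card (mono_at G c D) > card (mono_at G c' D) + m"
      unfolding near_min_def by (auto simp: not_le)
    \<comment> \<open>Since \<open>gt\<close> gives a saving of at least \<open>k0\<close> on
      \<open>D\<close>, any further saving on \<open>D2\<close> would exceed the slack
      \<open>k0\<close> on \<open>?D\<close>.\<close>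
    have "near_min G F 0 c'" unfolding near_min_def
    proof (intro allI impI; elim conjE)
      fix D2 c2 assume D2: "finite D2" "D2 \<subseteq> F" and c2: "\<forall>v. v \<notin> D2 \<longrightarrow> c2 v = c' v"
      let ?D = "D \<union> D2"
      have fin: "finite ?D" "?D \<subseteq> fin_verts G" using D D2 F by auto
      have "card (mono_at G c ?D) \<le> card (mono_at G c2 ?D) + k0"
        using k0 D D2 c2 c' by (intro near_minD[where F=F]) auto
      moreover have "card (mono_at G c ?D) + card (mono_at G c' D)
                   = card (mono_at G c' ?D) + card (mono_at G c D)"
        using c' by (intro mono_at_exchange[OF G fin]) auto
      moreover have "card (mono_at G c' ?D) + card (mono_at G c2 D2)
                   = card (mono_at G c2 ?D) + card (mono_at G c' D2)"
        using c2 by (intro mono_at_exchange[OF G fin]) auto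
      ultimately show "card (mono_at G c' D2) \<le> card (mono_at G c2 D2) + 0"
        using gt Suc by linarith
    qed
    then show ?thesis using D c' by blast
  qed
qed

lemma card_le_plus_image:
  assumes "A \<subseteq> B \<union> f ` N" "finite B" "finite N"
  shows "card A \<le> card B + card N"
proof -
  have "card A \<le> card (B \<union> f ` N)" using assms by (intro card_mono) auto
  also have "\<dots> \<le> card B + card (f ` N)" by (rule card_Un_le)
  also have "\<dots> \<le> card B + card N" using card_image_le[OF assms(3)] by simp
  finally show ?thesis .
qed

text \<open>At most \<open>card (nbrs G v)\<close> edges meet \<open>v\<close>. They are paid for
  twice: when \<open>v\<close> is dropped from \<open>D\<close>, and when \<open>v\<close> gets back
  its colour under \<open>c\<close> so that only vertices of \<open>F\<close> are
  recoloured.\<close>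

lemma near_min_insert:
  assumes G: "is_graph G" and F: "F \<subseteq> fin_verts G" and c: "near_min G F k c"
    and v: "v \<in> fin_verts G"
  shows "near_min G (insert v F) (k + 2 * card (nbrs G v)) c"
  unfolding near_min_def
proof (intro allI impI; elim conjE)
  fix D c' assume D: "finite D" "D \<subseteq> insert v F" and c': "\<forall>w. w \<notin> D \<longrightarrow> c' w = c w"
  let ?D = "D - {v}" and ?c = "c'(v := c v)" and ?N = "nbrs G v"
  have N: "finite ?N" using v unfolding fin_verts_def by auto
  have fin: "finite (mono_at G a B)" if "B \<subseteq> D" for a B
    using finite_mono_at[OF G, of B a] that D F v finite_subset by blast
  have "card (mono_at G c D) \<le> card (mono_at G c ?D) + card ?N"
    using edge_at_vertex[OF G] N fin
    by (intro card_le_plus_image[where f="\<lambda>y. {v, y}"]) (auto simp: mono_at_def, blast)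
  moreover have "card (mono_at G c ?D) \<le> card (mono_at G ?c ?D) + k"
    using c D c' by (intro near_minD[where F=F]) auto
  moreover have "card (mono_at G ?c ?D) \<le> card (mono_at G c' ?D) + card ?N"
  proof (rule card_le_plus_image[where f="\<lambda>y. {v, y}"])
    show "mono_at G ?c ?D \<subseteq> mono_at G c' ?D \<union> (\<lambda>y. {v, y}) ` ?N"
    proof
      fix e assume e: "e \<in> mono_at G ?c ?D"
      show "e \<in> mono_at G c' ?D \<union> (\<lambda>y. {v, y}) ` ?N"
      proof (cases "v \<in> e")
        case True
        then show ?thesis using edge_at_vertex[OF G _ True] e unfolding mono_at_def by auto
      next
        case False
        then have "\<forall>w\<in>e. ?c w = c' w" by auto
        then show ?thesis using e unfolding mono_at_def by auto
      qed
    qed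
  qed (use N fin in auto)
  moreover have "card (mono_at G c' ?D) \<le> card (mono_at G c' D)"
    using fin by (intro card_mono) (auto simp: mono_at_def)
  ultimately show "card (mono_at G c D) \<le> card (mono_at G c' D) + (k + 2 * card ?N)"
    by linarith
qed

lemma near_min_union:
  assumes G: "is_graph G" and "finite S" "S \<subseteq> fin_verts G" "F \<subseteq> fin_verts G" "near_min G F k c"
  shows "\<exists>k. near_min G (S \<union> F) k c"
  using assms(2,3)
proof (induction S rule: finite_induct)
  case empty
  then show ?case using assms(5) by auto
next
  case (insert v S)
  then obtain k where "near_min G (S \<union> F) k c" by auto
  from near_min_insert[OF G _ this, of v] insert.prems assms(4) show ?case by auto
qed

text \<open>The recolouring \<open>c1'\<close> after the flip is compared with the same recolouring
  \<open>?c'\<close> before it; they differ only at edges of \<open>x\<close>. The friends of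
  \<open>x\<close> in \<open>D\<close>, whose number is not bounded as \<open>D\<close> varies,
  cancel, and only opponents remain in the bound.\<close>

lemma near_min_flip:
  assumes G: "is_graph G" and F: "F \<subseteq> fin_verts G" and c: "near_min G F k c"
    and x: "x \<notin> F" and O: "finite (opp G c x \<inter> F)"
  shows "near_min G F (k + 2 * card (opp G c x \<inter> F)) (c(x := \<not> c x))"
  unfolding near_min_def
proof (intro allI impI; elim conjE)
  let ?c1 = "c(x := \<not> c x)"
  fix D c1' assume D: "finite D" "D \<subseteq> F" and c1': "\<forall>v. v \<notin> D \<longrightarrow> c1' v = ?c1 v"
  let ?c' = "c1'(x := c x)" and ?N = "nbrs G x \<inter> D" and ?O = "opp G c x \<inter> F"
  define Fr where "Fr = {y \<in> ?N. c y = c x}"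
  have fin: "finite (mono_at G a D)" for a
    using finite_mono_at[OF G, of D a] D F by blast
  have xD: "x \<notin> D" using x D by blast
  \<comment> \<open>The edges from \<open>x\<close> to \<open>Fr\<close> stop being monochromatic in
    the flip. Keeping them on the left is what lets \<open>card Fr\<close> cancel at the
    end.\<close>
  have "card (mono_at G ?c1 D \<union> (\<lambda>y. {x, y}) ` Fr) \<le> card (mono_at G c D) + card ?O"
  proof (rule card_le_plus_image[where f="\<lambda>y. {x, y}"])
    show "mono_at G ?c1 D \<union> (\<lambda>y. {x, y}) ` Fr \<subseteq> mono_at G c D \<union> (\<lambda>y. {x, y}) ` ?O"
    proof
      fix e assume e: "e \<in> mono_at G ?c1 D \<union> (\<lambda>y. {x, y}) ` Fr"
      show "e \<in> mono_at G c D \<union> (\<lambda>y. {x, y}) ` ?O"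
      proof (cases "e \<in> (\<lambda>y. {x, y}) ` Fr")
        case True
        then show ?thesis unfolding Fr_def mono_at_def nbrs_def by auto
      next
        case False
        then have e: "e \<in> mono_at G ?c1 D" using e by auto
        show ?thesis
        proof (cases "x \<in> e")
          case True
          then obtain y where "y \<in> nbrs G x" "e = {x, y}" "y \<noteq> x"
            using edge_at_vertex[OF G _ True] e unfolding mono_at_def by auto
          then show ?thesis using e xD D unfolding mono_at_def opp_def by auto
        next
          case False
          then have "\<forall>w\<in>e. ?c1 w = c w" by auto
          then show ?thesis using e unfolding mono_at_def by auto
        qed
      qed
    qed
  qed (use fin O in auto)
  moreover have "mono_at G ?c1 D \<inter> (\<lambda>y. {x, y}) ` Fr = {}"
    using nbrs_neq[OF G] unfolding mono_at_def Fr_def by auto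
  moreover have "card ((\<lambda>y. {x, y}) ` Fr) = card Fr"
    by (intro card_image inj_onI) (auto simp: doubleton_eq_iff)
  moreover have finFr: "finite Fr" using D unfolding Fr_def by auto
  ultimately have 1: "card (mono_at G ?c1 D) + card Fr \<le> card (mono_at G c D) + card ?O"
    using fin by (simp add: card_Un_disjoint)
  have 2: "card (mono_at G c D) \<le> card (mono_at G ?c' D) + k"
    using c D c1' xD by (intro near_minD[where F=F]) auto
  have 3: "card (mono_at G ?c' D) \<le> card (mono_at G c1' D) + card ?N"
  proof (rule card_le_plus_image[where f="\<lambda>y. {x, y}"])
    show "mono_at G ?c' D \<subseteq> mono_at G c1' D \<union> (\<lambda>y. {x, y}) ` ?N"
    proof
      fix e assume e: "e \<in> mono_at G ?c' D"
      show "e \<in> mono_at G c1' D \<union> (\<lambda>y. {x, y}) ` ?N"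
      proof (cases "x \<in> e")
        case True
        then show ?thesis using edge_at_vertex[OF G _ True] e xD unfolding mono_at_def by fastforce
      next
        case False
        then have "\<forall>w\<in>e. ?c' w = c1' w" by auto
        then show ?thesis using e unfolding mono_at_def by auto
      qed
    qed
  qed (use D fin in auto)
  have "card ?N \<le> card (Fr \<union> ?O)"
    using finFr O D by (intro card_mono) (auto simp: Fr_def opp_def)
  then have 4: "card ?N \<le> card Fr + card ?O" using card_Un_le[of Fr ?O] by linarith
  show "card (mono_at G ?c1 D) \<le> card (mono_at G c1' D) + (k + 2 * card ?O)"
    using 1 2 3 4 by linarith
qed

text \<open>Test minimality on \<open>{v}\<close>: the monochromatic edges at \<open>v\<close>
  correspond to its friends before a flip and to its opponents after it.\<close>

lemma locally_minimal_happy: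
  assumes G: "is_graph G" and c: "near_min G F 0 c" and v: "v \<in> F" "v \<in> fin_verts G"
  shows "card {y \<in> nbrs G v. c y = c v} \<le> card (opp G c v)"
proof -
  let ?c = "c(v := \<not> c v)"
  have im: "mono_at G b {v} = (\<lambda>y. {v, y}) ` {y \<in> nbrs G v. b y = b v}" for b
  proof
    show "mono_at G b {v} \<subseteq> (\<lambda>y. {v, y}) ` {y \<in> nbrs G v. b y = b v}"
      using edge_at_vertex[OF G] unfolding mono_at_def by fastforce
    show "(\<lambda>y. {v, y}) ` {y \<in> nbrs G v. b y = b v} \<subseteq> mono_at G b {v}"
      unfolding mono_at_def nbrs_def by auto
  qed
  have cd: "card (mono_at G b {v}) = card {y \<in> nbrs G v. b y = b v}" for b
    unfolding im by (intro card_image inj_onI) (auto simp: doubleton_eq_iff)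
  have "card (mono_at G c {v}) \<le> card (mono_at G ?c {v}) + 0"
    using c v by (intro near_minD[where F=F]) auto
  moreover have "{y \<in> nbrs G v. ?c y = ?c v} = opp G c v"
    using nbrs_neq[OF G] unfolding opp_def by auto
  ultimately show ?thesis by (simp only: cd)
qed

section \<open>Good colourings and flips\<close>

definition diff :: "'a ugraph \<Rightarrow> ('a \<Rightarrow> bool) \<Rightarrow> ('a \<Rightarrow> bool) \<Rightarrow> 'a set" where
  "diff G c c' = {v \<in> verts G. c v \<noteq> c' v}"

text \<open>At infinite degree, happiness amounts to having as many opponents as neighbours. At
  finite degree, unimprovability is demanded instead of happiness, because it bounds what can be
  saved after a flip.\<close>

definition good :: "'a ugraph \<Rightarrow> 'a set \<Rightarrow> ('a \<Rightarrow> bool) \<Rightarrow> bool" where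
  "good G U c \<longleftrightarrow>
     (\<forall>x \<in> V_inf G - U. |nbrs G x| \<le>o |opp G c x| ) \<and> near_min G (fin_verts G - U) 0 c"

definition extendable :: "'a ugraph \<Rightarrow> 'a set \<Rightarrow> bool" where
  "extendable G U \<longleftrightarrow> (\<forall>c. \<exists>c'. good G U c' \<and> (\<forall>u\<in>U. c' u = c u))"

definition flippable :: "'a ugraph \<Rightarrow> 'a set \<Rightarrow> bool" where
  "flippable G U \<longleftrightarrow>
     (\<forall>c. \<forall>x\<in>U. good G U c \<longrightarrow>
        (\<exists>c'. good G U c' \<and> c' x = (\<not> c x) \<and> (\<forall>u\<in>U - {x}. c' u = c u) \<and>
              (finite (diff G c c') \<or> |diff G c c'| \<le>o |opp G c x| )))"

lemma good_mono: "good G U c \<Longrightarrow> U \<subseteq> U' \<Longrightarrow> good G U' c"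
  unfolding good_def using near_min_antimono[of G "fin_verts G - U" 0 c "fin_verts G - U'"] by auto

lemma card_of_le_cover:
  assumes "infinite A" "A \<subseteq> B \<union> C" "|C| <o |A|"
  shows "|A| \<le>o |B|"
proof (rule ccontr)
  assume "\<not> |A| \<le>o |B|"
  then have "|B| <o |A|" by (simp add: not_ordLeq_iff_ordLess card_of_Well_order)
  then have "|B \<union> C| <o |A|" using assms card_of_Un_ordLess_infinite by blast
  moreover have "|A| \<le>o |B \<union> C|" using assms(2) by (rule card_of_mono1)
  ultimately show False using not_ordLess_ordLeq by blast
qed

text \<open>The opponents that \<open>t\<close> loses lie in \<open>diff G c c'\<close>, and an
  infinite set keeps its cardinality when a smaller set is removed.\<close>

lemma happy_stable:
  assumes t: "t \<in> V_inf G" and h: "|nbrs G t| \<le>o |opp G c t|"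
    and eq: "c' t = c t" and small: "|diff G c c'| <o |nbrs G t|"
  shows "|nbrs G t| \<le>o |opp G c' t|"
proof -
  have inf: "infinite (opp G c t)" using h t card_of_ordLeq_infinite unfolding V_inf_def by blast
  have "opp G c t \<subseteq> opp G c' t \<union> diff G c c'"
    using eq unfolding opp_def diff_def nbrs_def by auto
  then have "|opp G c t| \<le>o |opp G c' t|"
    using card_of_le_cover[OF inf] small h ordLess_ordLeq_trans by blast
  then show ?thesis using h ordLeq_transitive by blast
qed

lemma finite_card_of_less: "finite A \<Longrightarrow> infinite B \<Longrightarrow> |A| <o |B|"
  using finite_iff_ordLess_natLeq[of A] infinite_iff_natLeq_ordLeq[of B]
    ordLess_ordLeq_trans[of "|A|" natLeq "|B|"] by argo

lemma card_of_le_infinite: "finite A \<or> |A| \<le>o |B| \<Longrightarrow> infinite B \<Longrightarrow> |A| \<le>o |B|"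
  using finite_card_of_less[of A B] ordLess_imp_ordLeq[of "|A|" "|B|"] by argo

lemma card_of_Un_le: "infinite C \<Longrightarrow> |A| \<le>o |C| \<Longrightarrow> |B| \<le>o |C| \<Longrightarrow> |A \<union> B| \<le>o |C|"
  by (rule card_of_Un_ordLeq_infinite_Field) (auto simp: Field_card_of card_of_card_order_on)

lemma finite_ordLess_V_inf: "t \<in> V_inf G \<Longrightarrow> finite A \<Longrightarrow> |A| <o |nbrs G t|"
  unfolding V_inf_def by (simp add: finite_card_of_less)

text \<open>The improving recolouring touches only vertices of finite degree, and finitely many
  changes leave every happy vertex of infinite degree happy. Any finite slack \<open>k\<close>
  suffices.\<close>

lemma finite_repair:
  assumes G: "is_graph G" and nm: "near_min G (fin_verts G - U) k c"
    and h: "\<And>x. x \<in> V_inf G - U \<Longrightarrow> |nbrs G x| \<le>o |opp G c x|"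
  shows "\<exists>c'. good G U c' \<and> (\<forall>u\<in>U. c' u = c u) \<and> finite (diff G c c')"
proof -
  obtain D c' where D: "finite D" "D \<subseteq> fin_verts G - U" "\<And>v. v \<notin> D \<Longrightarrow> c' v = c v"
    and nm': "near_min G (fin_verts G - U) 0 c'"
    using near_min_improve[OF G _ nm] by blast
  have fin: "finite (diff G c c')"
    using D by (intro finite_subset[OF _ D(1)]) (auto simp: diff_def)
  have "|nbrs G x| \<le>o |opp G c' x|" if "x \<in> V_inf G - U" for x
  proof (rule happy_stable)
    show "x \<in> V_inf G" "|nbrs G x| \<le>o |opp G c x|" using that h by auto
    show "c' x = c x" using D that unfolding V_inf_def fin_verts_def by blast
    show "|diff G c c'| <o |nbrs G x|" using that finite_ordLess_V_inf[of x G, OF _ fin] by auto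
  qed
  then show ?thesis using D fin nm' unfolding good_def by blast
qed

lemma flip_happy:
  assumes c: "good G U c" and x: "x \<in> U" and t: "t \<in> V_inf G - U"
  shows "|nbrs G t| \<le>o |opp G (c(x := \<not> c x)) t|"
proof (rule happy_stable)
  let ?c = "c(x := \<not> c x)"
  show "t \<in> V_inf G" "|nbrs G t| \<le>o |opp G c t|" using t c unfolding good_def by auto
  show "?c t = c t" using t x by auto
  have "finite (diff G c ?c)" by (rule finite_subset[of _ "{x}"]) (auto simp: diff_def)
  then show "|diff G c ?c| <o |nbrs G t|" using t finite_ordLess_V_inf[of t G] by auto
qed

text \<open>If every opponent of \<open>x\<close> is precoloured, \<open>near_min_flip\<close> adds
  no slack, so the bare flip needs no repair.\<close>

lemma good_flip:
  assumes G: "is_graph G" and c: "good G U c" and x: "x \<in> U" and "opp G c x \<subseteq> U"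
  shows "good G U (c(x := \<not> c x))"
proof -
  have "opp G c x \<inter> (fin_verts G - U) = {}" using assms(4) by auto
  then show ?thesis
    using flip_happy[OF c x] near_min_flip[OF G, of "fin_verts G - U" 0 c x] c x
    unfolding good_def by auto
qed

text \<open>The case of finitely many opponents is settled here once and for all:
  \<open>near_min_flip\<close> leaves finite slack, which \<open>finite_repair\<close> removes with
  finitely many changes.\<close>

lemma flippableI:
  assumes G: "is_graph G"
    and inf: "\<And>c x. x \<in> U \<Longrightarrow> good G U c \<Longrightarrow> infinite (opp G c x) \<Longrightarrow>
        \<exists>c'. good G U c' \<and> c' x = (\<not> c x) \<and> (\<forall>u\<in>U - {x}. c' u = c u) \<and>
             |diff G c c'| \<le>o |opp G c x|"
  shows "flippable G U"
  unfolding flippable_def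
proof (intro allI ballI impI)
  fix c x assume x: "x \<in> U" and c: "good G U c"
  show "\<exists>c'. good G U c' \<and> c' x = (\<not> c x) \<and> (\<forall>u\<in>U - {x}. c' u = c u) \<and>
             (finite (diff G c c') \<or> |diff G c c'| \<le>o |opp G c x| )"
  proof (cases "finite (opp G c x)")
    case True
    let ?c = "c(x := \<not> c x)"
    have "near_min G (fin_verts G - U) (0 + 2 * card (opp G c x \<inter> (fin_verts G - U))) ?c"
      using x c True unfolding good_def by (intro near_min_flip[OF G]) auto
    moreover note flip_happy[OF c x]
    ultimately obtain c' where c': "good G U c'" "\<forall>u\<in>U. c' u = ?c u" "finite (diff G ?c c')"
      using finite_repair[OF G] by blast
    have "diff G c c' \<subseteq> insert x (diff G ?c c')" unfolding diff_def by auto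
    then have "finite (diff G c c')" using c'(3) finite_subset by blast
    then show ?thesis using c' x by (intro exI[of _ c']) auto
  next
    case False
    then show ?thesis using inf[OF x c] by blast
  qed
qed

text \<open>A vertex of infinite degree is not in \<open>fin_verts G\<close>, so releasing it adds
  only its own happiness to the requirements.\<close>

lemma good_of_insert:
  assumes "good G (insert t U) c" "t \<in> V_inf G" "|nbrs G t| \<le>o |opp G c t|"
  shows "good G U c"
proof -
  have "fin_verts G - insert t U = fin_verts G - U"
    using assms(2) unfolding V_inf_def fin_verts_def by auto
  then show ?thesis using assms unfolding good_def by auto
qed

text \<open>Friends of \<open>t\<close> that the repair leaves unchanged become opponents. The other
  neighbours are old opponents or changed vertices, both fewer than the degree of
  \<open>t\<close>.\<close>

lemma flip_unhappy:
  assumes fl: "flippable G (insert t U)" and t: "t \<in> V_inf G" "t \<notin> U"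
    and c: "good G (insert t U) c" and unh: "\<not> |nbrs G t| \<le>o |opp G c t|"
  shows "\<exists>c'. good G U c' \<and> (\<forall>u\<in>U. c' u = c u) \<and>
              (finite (diff G c c') \<or> |diff G c c'| \<le>o |opp G c t| )"
proof -
  obtain c' where c': "good G (insert t U) c'" "c' t = (\<not> c t)"
    "\<forall>u\<in>insert t U - {t}. c' u = c u" "finite (diff G c c') \<or> |diff G c c'| \<le>o |opp G c t|"
    using fl c unfolding flippable_def by blast
  have lt: "|opp G c t| <o |nbrs G t|"
    using unh by (simp add: not_ordLeq_iff_ordLess card_of_Well_order)
  have lt': "|diff G c c'| <o |nbrs G t|"
    using c'(4) ordLeq_ordLess_trans[OF _ lt] finite_ordLess_V_inf[OF t(1)] by auto
  have inf: "infinite (nbrs G t)" using t unfolding V_inf_def by auto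
  have "|nbrs G t| \<le>o |opp G c' t|"
  proof (rule card_of_le_cover[OF inf])
    show "nbrs G t \<subseteq> opp G c' t \<union> (opp G c t \<union> diff G c c')"
      using c'(2) unfolding opp_def diff_def nbrs_def by auto
    show "|opp G c t \<union> diff G c c'| <o |nbrs G t|"
      using lt lt' inf card_of_Un_ordLess_infinite by blast
  qed
  then have "good G U c'" by (rule good_of_insert[OF c'(1) t(1)])
  then show ?thesis using c' t by blast
qed

text \<open>Both claims are proved by acting with \<open>t\<close> still precoloured and then
  applying \<open>flip_unhappy\<close> to \<open>t\<close> if needed.\<close>

lemma uncolour_vertex:
  assumes G: "is_graph G" and t: "t \<in> V_inf G"
    and ex: "extendable G (insert t U)" and fl: "flippable G (insert t U)"
  shows "extendable G U \<and> flippable G U"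
proof (cases "t \<in> U")
  case True
  then show ?thesis using ex fl by (simp add: insert_absorb)
next
  case tU: False
  have "\<exists>c'. good G U c' \<and> (\<forall>u\<in>U. c' u = c u)" for c
  proof -
    obtain c1 where c1: "good G (insert t U) c1" "\<forall>u\<in>insert t U. c1 u = c u"
      using ex unfolding extendable_def by blast
    show ?thesis
    proof (cases "|nbrs G t| \<le>o |opp G c1 t|")
      case True
      then show ?thesis using c1(2) good_of_insert[OF c1(1) t True] by auto
    next
      case False
      then obtain c2 where "good G U c2" "\<forall>u\<in>U. c2 u = c1 u"
        using flip_unhappy[OF fl t tU c1(1)] by blast
      then show ?thesis using c1 by (intro exI[of _ c2]) auto
    qed
  qed
  moreover have "flippable G U"
  proof (rule flippableI[OF G])
    fix c x assume x: "x \<in> U" and c: "good G U c" and inf: "infinite (opp G c x)"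
    let ?b = "|opp G c x|"
    have "good G (insert t U) c" using c by (rule good_mono) auto
    then obtain c1 where c1: "good G (insert t U) c1" "c1 x = (\<not> c x)"
      "\<forall>u\<in>insert t U - {x}. c1 u = c u" "finite (diff G c c1) \<or> |diff G c c1| \<le>o ?b"
      using fl x unfolding flippable_def by blast
    have d1: "|diff G c c1| \<le>o ?b"
      using c1(4) inf by (rule card_of_le_infinite)
    show "\<exists>c'. good G U c' \<and> c' x = (\<not> c x) \<and> (\<forall>u\<in>U - {x}. c' u = c u) \<and> |diff G c c'| \<le>o ?b"
    proof (cases "|nbrs G t| \<le>o |opp G c1 t|")
      case True
      then show ?thesis using c1(2,3) d1 good_of_insert[OF c1(1) t True] by auto
    next
      case False
      then obtain c2 where c2: "good G U c2" "\<forall>u\<in>U. c2 u = c1 u"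
        "finite (diff G c1 c2) \<or> |diff G c1 c2| \<le>o |opp G c1 t|"
        using flip_unhappy[OF fl t tU c1(1)] by metis
      \<comment> \<open>The first flip made \<open>t\<close> unhappy, so it changed at least as many vertices as \<open>t\<close> has neighbours.\<close>
      have ht: "|nbrs G t| \<le>o |opp G c t|" using c t tU unfolding good_def by blast
      have "c1 t = c t" using c1(3) x tU by auto
      then have "\<not> |diff G c c1| <o |nbrs G t|"
        using happy_stable[OF t ht] False by blast
      then have "|nbrs G t| \<le>o |diff G c c1|"
        by (simp add: not_ordLess_iff_ordLeq card_of_Well_order)
      moreover have "|opp G c1 t| \<le>o |nbrs G t|"
        by (rule card_of_mono1) (auto simp: opp_def)
      ultimately have "|opp G c1 t| \<le>o ?b" using d1 ordLeq_transitive by blast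
      then have "finite (diff G c1 c2) \<or> |diff G c1 c2| \<le>o ?b"
        using c2(3) ordLeq_transitive by blast
      then have d2: "|diff G c1 c2| \<le>o ?b" using inf by (rule card_of_le_infinite)
      have "diff G c c2 \<subseteq> diff G c c1 \<union> diff G c1 c2" unfolding diff_def by auto
      then have "|diff G c c2| \<le>o |diff G c c1 \<union> diff G c1 c2|" by (rule card_of_mono1)
      moreover have "|diff G c c1 \<union> diff G c1 c2| \<le>o ?b"
        using inf d1 d2 by (rule card_of_Un_le)
      ultimately have "|diff G c c2| \<le>o ?b" using ordLeq_transitive by blast
      then show ?thesis using c1 c2 x by (intro exI[of _ c2]) auto
    qed
  qed
  ultimately show ?thesis unfolding extendable_def by blast
qed

lemma uncolour_finite:
  assumes G: "is_graph G" and "finite T" "T \<subseteq> V_inf G"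
    and "extendable G (T \<union> U)" "flippable G (T \<union> U)"
  shows "extendable G U \<and> flippable G U"
  using assms(2-)
proof (induction T rule: finite_induct)
  case (insert t T)
  then show ?case using uncolour_vertex[OF G, of t "T \<union> U"] by simp
qed simp

section \<open>Gluing along a finite separator\<close>

lemma verts_induced [simp]: "verts (induced G U) = U"
  unfolding induced_def by simp

lemma is_graph_induced: "is_graph G \<Longrightarrow> is_graph (induced G U)"
  unfolding is_graph_def induced_def by auto

lemma nbrs_induced: "U \<subseteq> verts G \<Longrightarrow> x \<in> U \<Longrightarrow> nbrs (induced G U) x = nbrs G x \<inter> U"
  unfolding nbrs_def induced_def by auto

lemma good_cong:
  assumes G: "is_graph G" and c: "good G U c" and eq: "\<And>v. v \<in> verts G \<Longrightarrow> c' v = c v"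
  shows "good G U c'"
proof -
  have "opp G c' x = opp G c x" if "x \<in> verts G" for x
    using eq that unfolding opp_def nbrs_def by auto
  moreover have "near_min G (fin_verts G - U) 0 c'"
    unfolding near_min_def
  proof (intro allI impI; elim conjE)
    fix D b assume D: "finite D" "D \<subseteq> fin_verts G - U" and b: "\<forall>v. v \<notin> D \<longrightarrow> b v = c' v"
    \<comment> \<open>The recolouring \<open>b\<close> of \<open>c'\<close> transferred to
      \<open>c\<close>; inside \<open>verts G\<close> it agrees with \<open>b\<close>.\<close>
    let ?b = "\<lambda>v. if v \<in> D then b v else c v"
    have DV: "D \<union> (\<Union>d\<in>D. nbrs G d) \<subseteq> verts G"
      using D unfolding fin_verts_def nbrs_def by auto
    have "card (mono_at G c D) \<le> card (mono_at G ?b D) + 0"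
      using c D unfolding good_def by (intro near_minD[where F="fin_verts G - U"]) auto
    moreover have "mono_at G c D = mono_at G c' D"
      using DV eq by (intro mono_at_cong[OF G]) auto
    moreover have "mono_at G ?b D = mono_at G b D"
    proof (rule mono_at_cong[OF G])
      fix v assume "v \<in> D \<union> (\<Union>d\<in>D. nbrs G d)"
      then have "v \<in> verts G" using DV by blast
      then show "?b v = b v" using b eq by auto
    qed
    ultimately show "card (mono_at G c' D) \<le> card (mono_at G b D) + 0" by simp
  qed
  ultimately show ?thesis using c unfolding good_def V_inf_def by auto
qed

locale separation =
  fixes G :: "'a ugraph" and S :: "'a set" and \<C> :: "'a set set"
  assumes graph: "is_graph G" and SV: "S \<subseteq> verts G" and finS: "finite S"
    and cover: "\<Union>\<C> = verts G - S"
    and disj: "C \<in> \<C> \<Longrightarrow> C' \<in> \<C> \<Longrightarrow> v \<in> C \<Longrightarrow> v \<in> C' \<Longrightarrow> C = C'"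
    and closed: "C \<in> \<C> \<Longrightarrow> v \<in> C \<Longrightarrow> nbrs G v \<subseteq> C \<union> S"
begin

text \<open>All of \<open>S\<close> is included, so that vertices of the piece keep their full
  neighbourhoods. Edges inside \<open>S\<close> then occur in every part, which is harmless because
  \<open>S\<close> is precoloured there.\<close>

abbreviation "part C \<equiv> induced G (C \<union> S)"

definition "cell v = (THE C. C \<in> \<C> \<and> v \<in> C)"

lemma cell_eq: "C \<in> \<C> \<Longrightarrow> v \<in> C \<Longrightarrow> cell v = C"
  unfolding cell_def by (rule the_equality) (auto dest: disj)

lemma part_sub: "C \<in> \<C> \<Longrightarrow> C \<union> S \<subseteq> verts G"
  using cover SV by blast

lemma not_S: "C \<in> \<C> \<Longrightarrow> v \<in> C \<Longrightarrow> v \<notin> S"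
  using cover by blast

lemma nbrs_part: "C \<in> \<C> \<Longrightarrow> v \<in> C \<Longrightarrow> nbrs (part C) v = nbrs G v"
  using nbrs_induced[OF part_sub] closed by blast

lemma opp_part: "C \<in> \<C> \<Longrightarrow> v \<in> C \<Longrightarrow> opp (part C) c v = opp G c v"
  unfolding opp_def using nbrs_part by simp

lemma V_inf_part: "C \<in> \<C> \<Longrightarrow> V_inf (part C) - (U \<union> S) = (V_inf G - (U \<union> S)) \<inter> C"
  using nbrs_part[of C] part_sub[of C] not_S[of C] unfolding V_inf_def by auto

lemma fin_verts_part: "C \<in> \<C> \<Longrightarrow> fin_verts (part C) - (U \<union> S) = (fin_verts G - (U \<union> S)) \<inter> C"
  using nbrs_part[of C] part_sub[of C] not_S[of C] unfolding fin_verts_def by auto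

lemma mono_at_part:
  assumes "C \<in> \<C>" "D \<subseteq> C"
  shows "mono_at (part C) c D = mono_at G c D"
proof -
  have "e \<subseteq> C \<union> S" if "e \<in> edges G" "e \<inter> D \<noteq> {}" for e
    using edge_at_vertex[OF graph that(1)] closed[OF assms(1)] assms(2) that(2) by blast
  then show ?thesis unfolding mono_at_def induced_def by auto
qed

lemma good_part:
  assumes C: "C \<in> \<C>" and c: "good G (U \<union> S) c"
  shows "good (part C) (U \<union> S) c"
  unfolding good_def V_inf_part[OF C] fin_verts_part[OF C]
proof
  show "\<forall>x\<in>(V_inf G - (U \<union> S)) \<inter> C. |nbrs (part C) x| \<le>o |opp (part C) c x|"
    using c nbrs_part[OF C] opp_part[OF C] unfolding good_def by auto
  have "near_min G ((fin_verts G - (U \<union> S)) \<inter> C) 0 c"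
    using c near_min_antimono[of G _ 0 c] unfolding good_def by auto
  then show "near_min (part C) ((fin_verts G - (U \<union> S)) \<inter> C) 0 c"
    unfolding near_min_def using mono_at_part[OF C] by auto
qed

text \<open>No edge meets two pieces, so the count splits over the pieces that meet
  \<open>D\<close>; these are finitely many even when \<open>\<C>\<close> is infinite.\<close>

lemma card_mono_at_cells:
  assumes D: "finite D" "D \<subseteq> fin_verts G - S"
  shows "card (mono_at G b D) = (\<Sum>C\<in>{C \<in> \<C>. C \<inter> D \<noteq> {}}. card (mono_at G b (D \<inter> C)))"
proof -
  let ?\<D> = "{C \<in> \<C>. C \<inter> D \<noteq> {}}"
  have "?\<D> \<subseteq> cell ` D"
  proof
    fix C assume "C \<in> ?\<D>"
    then obtain v where "C \<in> \<C>" "v \<in> C" "v \<in> D" by auto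
    then show "C \<in> cell ` D" using cell_eq by blast
  qed
  then have fin: "finite ?\<D>" using D finite_surj by blast
  have "mono_at G b D = (\<Union>C\<in>?\<D>. mono_at G b (D \<inter> C))"
  proof
    show "mono_at G b D \<subseteq> (\<Union>C\<in>?\<D>. mono_at G b (D \<inter> C))"
    proof
      fix e assume e: "e \<in> mono_at G b D"
      then obtain v where v: "v \<in> e" "v \<in> D" unfolding mono_at_def by auto
      then obtain C where "C \<in> \<C>" "v \<in> C" using D cover unfolding fin_verts_def by blast
      then show "e \<in> (\<Union>C\<in>?\<D>. mono_at G b (D \<inter> C))" using e v unfolding mono_at_def by auto
    qed
    show "(\<Union>C\<in>?\<D>. mono_at G b (D \<inter> C)) \<subseteq> mono_at G b D" unfolding mono_at_def by auto
  qed
  moreover have "mono_at G b (D \<inter> C) \<inter> mono_at G b (D \<inter> C') = {}"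
    if "C \<in> ?\<D>" "C' \<in> ?\<D>" "C \<noteq> C'" for C C'
  proof (rule ccontr)
    assume "mono_at G b (D \<inter> C) \<inter> mono_at G b (D \<inter> C') \<noteq> {}"
    then obtain e v w where e: "e \<in> edges G" and v: "v \<in> e" "v \<in> C" and w: "w \<in> e" "w \<in> C'"
      unfolding mono_at_def by auto
    have "w \<in> C \<union> S"
      using edge_at_vertex[OF graph e v(1)] closed[of C v] that v w(1) by auto
    then show False using disj[of C C' w] not_S[of C' w] that w by auto
  qed
  moreover have "finite (mono_at G b (D \<inter> C))" for C
    using D by (intro finite_mono_at[OF graph]) auto
  ultimately show ?thesis using fin by (simp add: card_UN_disjoint)
qed

text \<open>A global recolouring restricts to each part, where it saves nothing, and the savings add
  up by \<open>card_mono_at_cells\<close>.\<close>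

lemma good_glue:
  assumes c: "\<And>C. C \<in> \<C> \<Longrightarrow> good (part C) (U \<union> S) c"
  shows "good G (U \<union> S) c"
  unfolding good_def
proof
  show "\<forall>x\<in>V_inf G - (U \<union> S). |nbrs G x| \<le>o |opp G c x|"
  proof
    fix x assume x: "x \<in> V_inf G - (U \<union> S)"
    then obtain C where C: "C \<in> \<C>" "x \<in> C" using cover unfolding V_inf_def by blast
    have "x \<in> V_inf (part C) - (U \<union> S)" using V_inf_part[OF C(1)] C x by auto
    then have "|nbrs (part C) x| \<le>o |opp (part C) c x|" using c[OF C(1)] unfolding good_def by blast
    then show "|nbrs G x| \<le>o |opp G c x|" using nbrs_part[OF C] opp_part[OF C] by simp
  qed
  show "near_min G (fin_verts G - (U \<union> S)) 0 c"
    unfolding near_min_def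
  proof (intro allI impI; elim conjE)
    fix D c' assume D: "finite D" "D \<subseteq> fin_verts G - (U \<union> S)" and c': "\<forall>v. v \<notin> D \<longrightarrow> c' v = c v"
    have "card (mono_at G c (D \<inter> C)) \<le> card (mono_at G c' (D \<inter> C))" if C: "C \<in> \<C>" for C
    proof -
      \<comment> \<open>Only the changes inside \<open>C\<close> are kept; edges at
        \<open>D \<inter> C\<close> cannot see the others.\<close>
      let ?c = "\<lambda>v. if v \<in> D \<inter> C then c' v else c v"
      have "card (mono_at (part C) c (D \<inter> C)) \<le> card (mono_at (part C) ?c (D \<inter> C)) + 0"
        using c[OF C] D fin_verts_part[OF C] unfolding good_def
        by (intro near_minD[where F="fin_verts (part C) - (U \<union> S)"]) auto
      moreover have "mono_at G ?c (D \<inter> C) = mono_at G c' (D \<inter> C)"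
      proof (rule mono_at_cong[OF graph])
        fix v assume "v \<in> D \<inter> C \<union> (\<Union>d\<in>D \<inter> C. nbrs G d)"
        then have "v \<in> C \<union> S" using closed[OF C] by blast
        then show "?c v = c' v" using D c' by auto
      qed
      ultimately show ?thesis using mono_at_part[OF C] by auto
    qed
    then have "(\<Sum>C\<in>{C \<in> \<C>. C \<inter> D \<noteq> {}}. card (mono_at G c (D \<inter> C)))
             \<le> (\<Sum>C\<in>{C \<in> \<C>. C \<inter> D \<noteq> {}}. card (mono_at G c' (D \<inter> C)))"
      by (intro sum_mono) auto
    moreover have "D \<subseteq> fin_verts G - S" using D(2) by blast
    ultimately show "card (mono_at G c D) \<le> card (mono_at G c' D) + 0"
      using card_mono_at_cells[OF D(1)] by simp
  qed
qed

text \<open>Different parts overlap only in \<open>S\<close>, where every \<open>b C\<close> agrees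
  with \<open>c0\<close>.\<close>

lemma glue_colourings:
  assumes b: "\<And>C. C \<in> \<C> \<Longrightarrow> good (part C) (U \<union> S) (b C) \<and> (\<forall>u\<in>U \<union> S. b C u = c0 u)"
  shows "\<exists>c. good G (U \<union> S) c \<and> (\<forall>u\<in>U \<union> S. c u = c0 u) \<and> (\<forall>C\<in>\<C>. \<forall>v\<in>C. c v = b C v)"
proof -
  define c where "c v = (if v \<in> verts G - S then b (cell v) v else c0 v)" for v
  have cb: "c v = b C v" if "C \<in> \<C>" "v \<in> C" for C v
    using that cover cell_eq[OF that] unfolding c_def by auto
  have cu: "c u = c0 u" if "u \<in> U \<union> S" for u
  proof (cases "u \<in> verts G - S")
    case True
    then obtain C where "C \<in> \<C>" "u \<in> C" using cover by blast
    then show ?thesis using cb b that by auto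
  qed (simp only: c_def if_False)
  have "good (part C) (U \<union> S) c" if C: "C \<in> \<C>" for C
  proof (rule good_cong[OF is_graph_induced[OF graph]])
    show "good (part C) (U \<union> S) (b C)" using b C by blast
    fix v assume "v \<in> verts (part C)"
    then show "c v = b C v" using cb[OF C] cu b[OF C] by auto
  qed
  then have "good G (U \<union> S) c" by (rule good_glue)
  then show ?thesis using cb cu by blast
qed

text \<open>The vertices of \<open>S\<close> outside \<open>U\<close> are finitely many and of
  finite degree. Freeing them costs finite slack by \<open>near_min_union\<close>, which
  \<open>finite_repair\<close> then removes.\<close>

lemma repair_separator:
  assumes U: "V_inf G \<inter> S \<subseteq> U" and c: "good G (U \<union> S) c"
  shows "\<exists>c'. good G U c' \<and> (\<forall>u\<in>U. c' u = c u) \<and> finite (diff G c c')"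
proof -
  let ?S = "(S \<inter> fin_verts G) - U"
  obtain k where "near_min G (?S \<union> (fin_verts G - (U \<union> S))) k c"
    using near_min_union[OF graph, of ?S "fin_verts G - (U \<union> S)" 0 c] finS c
    unfolding good_def by auto
  moreover have "?S \<union> (fin_verts G - (U \<union> S)) = fin_verts G - U" by auto
  ultimately have "near_min G (fin_verts G - U) k c" by simp
  moreover have "|nbrs G x| \<le>o |opp G c x|" if "x \<in> V_inf G - U" for x
    using c U that unfolding good_def by auto
  ultimately show ?thesis using finite_repair[OF graph] by blast
qed

text \<open>For a flip at \<open>x\<close>, only pieces that contain \<open>x\<close> or one of its
  opponents have to change. There are at most \<open>|?O|\<close> of these, each changed in at most
  \<open>|?O|\<close> vertices, and an infinite cardinal absorbs the product.\<close>

lemma extendable_flippable: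
  assumes U: "V_inf G \<inter> S \<subseteq> U"
    and parts: "\<And>C. C \<in> \<C> \<Longrightarrow> extendable (part C) (U \<union> S) \<and> flippable (part C) (U \<union> S)"
  shows "extendable G U \<and> flippable G U"
proof
  show "extendable G U"
    unfolding extendable_def
  proof
    fix c0
    have "\<forall>C\<in>\<C>. \<exists>b. good (part C) (U \<union> S) b \<and> (\<forall>u\<in>U \<union> S. b u = c0 u)"
      using parts unfolding extendable_def by blast
    then obtain b where "\<forall>C\<in>\<C>. good (part C) (U \<union> S) (b C) \<and> (\<forall>u\<in>U \<union> S. b C u = c0 u)"
      by metis
    then obtain c where c: "good G (U \<union> S) c" "\<forall>u\<in>U \<union> S. c u = c0 u"
      using glue_colourings[of U b c0] by blast
    then obtain c' where "good G U c'" "\<forall>u\<in>U. c' u = c u"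
      using repair_separator[OF U] by blast
    then show "\<exists>c'. good G U c' \<and> (\<forall>u\<in>U. c' u = c0 u)" using c by auto
  qed
  show "flippable G U"
  proof (rule flippableI[OF graph])
    fix c x assume x: "x \<in> U" and c: "good G U c" and inf: "infinite (opp G c x)"
    let ?O = "opp G c x" and ?c0 = "c(x := \<not> c x)"
    have cS: "good G (U \<union> S) c" using c by (rule good_mono) auto
    have "\<exists>b. good (part C) (U \<union> S) b \<and> (\<forall>u\<in>U \<union> S. b u = ?c0 u) \<and>
              |diff (part C) c b| \<le>o |?O| \<and> (C \<inter> insert x ?O = {} \<longrightarrow> (\<forall>v\<in>C. b v = c v))"
      if C: "C \<in> \<C>" for C
    proof -
      note H = is_graph_induced[OF graph, of "C \<union> S"]
      have g: "good (part C) (U \<union> S) c" using C cS by (rule good_part)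
      have same: "diff (part C) c ?c0 \<subseteq> {x}" unfolding diff_def by auto
      then have d: "|diff (part C) c ?c0| \<le>o |?O|"
        using card_of_le_infinite[OF _ inf] finite_subset by blast
      \<comment> \<open>If the part misses \<open>x\<close>, the flip is invisible in it. If
        \<open>x\<close> lies in \<open>S\<close> and has no opponent in \<open>C\<close>, the bare
        flip is good by \<open>good_flip\<close>. Only the third case calls on the flippability of
        the part.\<close>
      consider "x \<notin> C \<union> S" | "x \<in> C \<union> S" "C \<inter> insert x ?O = {}" | "x \<in> C \<union> S" "C \<inter> insert x ?O \<noteq> {}"
        by blast
      then show ?thesis
      proof cases
        case 1
        then have "good (part C) (U \<union> S) ?c0" by (intro good_cong[OF H g]) auto
        then show ?thesis using d 1 by (intro exI[of _ ?c0]) auto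
      next
        case 2
        have "opp (part C) c x \<subseteq> U \<union> S"
          using 2 nbrs_induced[OF part_sub[OF C] 2(1)] unfolding opp_def by auto
        then have "good (part C) (U \<union> S) ?c0" using good_flip[OF H g] x by blast
        then show ?thesis using d 2 by (intro exI[of _ ?c0]) auto
      next
        case 3
        obtain b where b: "good (part C) (U \<union> S) b" "b x = (\<not> c x)"
          "\<forall>u\<in>U \<union> S - {x}. b u = c u"
          "finite (diff (part C) c b) \<or> |diff (part C) c b| \<le>o |opp (part C) c x|"
          using parts[OF C] g x unfolding flippable_def by (metis UnI1)
        have "opp (part C) c x \<subseteq> ?O"
          using nbrs_induced[OF part_sub[OF C] 3(1)] unfolding opp_def by auto
        then have "|opp (part C) c x| \<le>o |?O|" by (rule card_of_mono1)
        then have "finite (diff (part C) c b) \<or> |diff (part C) c b| \<le>o |?O|"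
          using b(4) ordLeq_transitive by blast
        then have "|diff (part C) c b| \<le>o |?O|" using inf by (rule card_of_le_infinite)
        then show ?thesis using b 3 by (intro exI[of _ b]) auto
      qed
    qed
    then have "\<forall>C\<in>\<C>. \<exists>b. good (part C) (U \<union> S) b \<and> (\<forall>u\<in>U \<union> S. b u = ?c0 u) \<and>
        |diff (part C) c b| \<le>o |?O| \<and> (C \<inter> insert x ?O = {} \<longrightarrow> (\<forall>v\<in>C. b v = c v))"
      by blast
    from bchoice[OF this] obtain b where
      b: "\<forall>C\<in>\<C>. good (part C) (U \<union> S) (b C) \<and> (\<forall>u\<in>U \<union> S. b C u = ?c0 u) \<and>
        |diff (part C) c (b C)| \<le>o |?O| \<and>
        (C \<inter> insert x ?O = {} \<longrightarrow> (\<forall>v\<in>C. b C v = c v))" ..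
    obtain c1 where c1: "good G (U \<union> S) c1" "\<forall>u\<in>U \<union> S. c1 u = ?c0 u"
      "\<forall>C\<in>\<C>. \<forall>v\<in>C. c1 v = b C v"
      using glue_colourings[of U b ?c0] b by blast
    obtain c2 where c2: "good G U c2" "\<forall>u\<in>U. c2 u = c1 u" "finite (diff G c1 c2)"
      using repair_separator[OF U c1(1)] by blast
    let ?\<D> = "{C \<in> \<C>. C \<inter> insert x ?O \<noteq> {}}"
    let ?X = "\<Union>C\<in>?\<D>. diff (part C) c (b C)"
    have "?\<D> \<subseteq> cell ` insert x ?O"
    proof
      fix C assume "C \<in> ?\<D>"
      then obtain v where "C \<in> \<C>" "v \<in> C" "v \<in> insert x ?O" by auto
      then show "C \<in> cell ` insert x ?O" using cell_eq by blast
    qed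
    then have "|?\<D>| \<le>o |insert x ?O|" using surj_imp_ordLeq by blast
    moreover have "|insert x ?O| \<le>o |?O|"
      using card_of_Un_le[OF inf card_of_le_infinite[OF _ inf] card_of_mono1, of "{x}" ?O] by simp
    ultimately have "|?\<D>| \<le>o |?O|" using ordLeq_transitive by blast
    then have X: "|?X| \<le>o |?O|"
      using inf b by (intro card_of_UNION_ordLeq_infinite) auto
    \<comment> \<open>Pieces outside \<open>?\<D>\<close> keep their colours under \<open>b\<close>,
      so the changes outside \<open>?X\<close> lie in \<open>S\<close> or stem from the final
      repair.\<close>
    have "diff G c c2 \<subseteq> ?X \<union> (S \<union> diff G c1 c2)"
    proof
      fix v assume v: "v \<in> diff G c c2"
      show "v \<in> ?X \<union> (S \<union> diff G c1 c2)"
      proof (rule ccontr)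
        assume n: "v \<notin> ?X \<union> (S \<union> diff G c1 c2)"
        then have vV: "v \<in> verts G - S" and ne: "c v \<noteq> c1 v" using v unfolding diff_def by auto
        then obtain C where C: "C \<in> \<C>" "v \<in> C" using cover by blast
        then have "c v \<noteq> b C v" using c1(3) ne by auto
        then have "C \<in> ?\<D>" "v \<in> diff (part C) c (b C)"
          using C b unfolding diff_def by auto
        then show False using n by blast
      qed
    qed
    then have "|diff G c c2| \<le>o |?X \<union> (S \<union> diff G c1 c2)|" by (rule card_of_mono1)
    moreover have "|?X \<union> (S \<union> diff G c1 c2)| \<le>o |?O|"
      using X finS c2(3) by (intro card_of_Un_le[OF inf] card_of_le_infinite[OF _ inf]) auto
    ultimately have "|diff G c c2| \<le>o |?O|" using ordLeq_transitive by blast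
    then show "\<exists>c'. good G U c' \<and> c' x = (\<not> c x) \<and> (\<forall>u\<in>U - {x}. c' u = c u) \<and> |diff G c c'| \<le>o |?O|"
      using c1(2) c2 x by (intro exI[of _ c2]) auto
  qed
qed

end

section \<open>Countable graphs\<close>

text \<open>Sequential compactness: nested infinite index sets settle the colours of the members of
  \<open>Y\<close> one after another.\<close>

lemma infinite_agreement:
  fixes cc :: "nat \<Rightarrow> 'a \<Rightarrow> bool"
  assumes "countable Y"
  shows "\<exists>c. \<forall>W. finite W \<and> W \<subseteq> Y \<longrightarrow> infinite {n. \<forall>v\<in>W. cc n v = c v}"
proof -
  let ?e = "from_nat_into Y"
  have "\<exists>f. \<forall>n. infinite (f n) \<and> (f (Suc n) \<subseteq> f n \<and> (\<exists>b. \<forall>m\<in>f (Suc n). cc m (?e n) = b))"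
  proof (rule dependent_nat_choice)
    show "\<exists>A :: nat set. infinite A" using infinite_UNIV_nat by blast
    fix A :: "nat set" and n assume A: "infinite A"
    have "A = {m \<in> A. cc m (?e n) = True} \<union> {m \<in> A. cc m (?e n) = False}" by auto
    then have "infinite {m \<in> A. cc m (?e n) = True} \<or> infinite {m \<in> A. cc m (?e n) = False}"
      using A by (metis finite_Un)
    then obtain b where "infinite {m \<in> A. cc m (?e n) = b}" by blast
    then show "\<exists>B. infinite B \<and> B \<subseteq> A \<and> (\<exists>b. \<forall>m\<in>B. cc m (?e n) = b)"
      by (intro exI[of _ "{m \<in> A. cc m (?e n) = b}"]) auto
  qed
  then obtain f where f: "\<And>n. infinite (f n)" "\<And>n. f (Suc n) \<subseteq> f n"
    "\<And>n. \<exists>b. \<forall>m\<in>f (Suc n). cc m (?e n) = b" by blast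
  have anti: "f n \<subseteq> f m" if "m \<le> n" for m n
    using lift_Suc_antimono_le[of f, OF f(2) that] .
  \<comment> \<open>All indices in this nonempty set agree at \<open>v\<close>, so any of them gives
    the limit colour. The \<open>Suc\<close> is there because the vertex numbered \<open>n\<close>
    is settled only in \<open>f (Suc n)\<close>.\<close>
  define c where "c v = (\<exists>m\<in>f (Suc (to_nat_on Y v)). cc m v)" for v
  have c: "cc m v = c v" if "v \<in> Y" "m \<in> f (Suc (to_nat_on Y v))" for m v
    using f(3)[of "to_nat_on Y v"] that assms unfolding c_def by auto
  have "infinite {n. \<forall>v\<in>W. cc n v = c v}" if W: "finite W" "W \<subseteq> Y" for W
  proof -
    obtain N where N: "\<forall>n\<in>(\<lambda>v. Suc (to_nat_on Y v)) ` W. n \<le> N"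
      using W(1) finite_nat_set_iff_bounded_le by blast
    have "f N \<subseteq> {n. \<forall>v\<in>W. cc n v = c v}"
      using anti N c W(2) by blast
    then show ?thesis using f(1) finite_subset by blast
  qed
  then show ?thesis by blast
qed

text \<open>Optimal colourings exist for each finite set \<open>Fn n\<close> exhausting
  \<open>F\<close>, and a limit of them is unimprovable because a finite \<open>D\<close> and its
  neighbours are only finitely many vertices.\<close>

lemma locally_minimal_exists:
  assumes G: "is_graph G" and F: "countable F" "F \<subseteq> fin_verts G"
  shows "\<exists>d. (\<forall>v. v \<notin> F \<longrightarrow> d v = c v) \<and> near_min G F 0 d"
proof -
  define Fn where "Fn n = {v \<in> F. to_nat_on F v < n}" for n
  have finFn: "finite (Fn n)" for n
  proof (rule finite_imageD)
    show "finite (to_nat_on F ` Fn n)"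
      by (rule finite_subset[of _ "{..<n}"]) (auto simp: Fn_def)
    show "inj_on (to_nat_on F) (Fn n)"
      using inj_on_to_nat_on[OF F(1)] by (rule inj_on_subset) (auto simp: Fn_def)
  qed
  have FnF: "Fn n \<subseteq> F" for n unfolding Fn_def by auto
  have "\<exists>b. (\<forall>v. v \<notin> Fn n \<longrightarrow> b v = c v) \<and>
            (\<forall>b'. (\<forall>v. v \<notin> Fn n \<longrightarrow> b' v = c v) \<longrightarrow>
                  card (mono_at G b (Fn n)) \<le> card (mono_at G b' (Fn n)))" for n
    using ex_has_least_nat[of "\<lambda>b. \<forall>v. v \<notin> Fn n \<longrightarrow> b v = c v" c "\<lambda>b. card (mono_at G b (Fn n))"]
    by auto
  then obtain cc where off: "\<And>n v. v \<notin> Fn n \<Longrightarrow> cc n v = c v" and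
    least: "\<And>n b'. (\<And>v. v \<notin> Fn n \<Longrightarrow> b' v = c v) \<Longrightarrow>
              card (mono_at G (cc n) (Fn n)) \<le> card (mono_at G b' (Fn n))"
    by metis
  obtain d0 where d0: "\<And>W. finite W \<Longrightarrow> W \<subseteq> F \<Longrightarrow> infinite {n. \<forall>v\<in>W. cc n v = d0 v}"
    using infinite_agreement[OF F(1), of cc] by blast
  define d where "d v = (if v \<in> F then d0 v else c v)" for v
  have "near_min G F 0 d"
    unfolding near_min_def
  proof (intro allI impI; elim conjE)
    fix D b assume D: "finite D" "D \<subseteq> F" and b: "\<forall>v. v \<notin> D \<longrightarrow> b v = d v"
    let ?W = "D \<union> (\<Union>x\<in>D. nbrs G x)"
    have "finite ?W" using D F unfolding fin_verts_def by auto
    \<comment> \<open>Some \<open>n\<close> has \<open>cc n\<close> agreeing with the limit on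
      \<open>D\<close> and its neighbours and is also so large that \<open>D\<close> lies in
      \<open>Fn n\<close>. Minimality on \<open>Fn n\<close> then passes to \<open>D\<close> by
      \<open>mono_at_exchange\<close>.\<close>
    then have "infinite {n. \<forall>v\<in>?W \<inter> F. cc n v = d0 v}" by (intro d0) auto
    moreover obtain m where m: "\<forall>i\<in>to_nat_on F ` D. i < m"
      using D(1) finite_nat_set_iff_bounded by blast
    ultimately obtain n where n: "n > m" "\<forall>v\<in>?W \<inter> F. cc n v = d0 v"
      unfolding infinite_nat_iff_unbounded by blast
    have DFn: "D \<subseteq> Fn n" using m n(1) D(2) unfolding Fn_def by fastforce
    have eq: "cc n v = d v" if "v \<in> ?W" for v
      using n(2) that off[of v n] FnF[of n] unfolding d_def by auto
    let ?b = "\<lambda>v. if v \<in> D then b v else cc n v"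
    have "card (mono_at G (cc n) (Fn n)) \<le> card (mono_at G ?b (Fn n))"
      using off DFn by (intro least) auto
    moreover have "card (mono_at G (cc n) (Fn n)) + card (mono_at G ?b D)
                 = card (mono_at G ?b (Fn n)) + card (mono_at G (cc n) D)"
      using finFn FnF[of n] F(2) DFn by (intro mono_at_exchange[OF G]) auto
    moreover have "mono_at G (cc n) D = mono_at G d D"
      using eq by (rule mono_at_cong[OF G])
    moreover have "mono_at G ?b D = mono_at G b D"
      using eq b by (intro mono_at_cong[OF G]) auto
    ultimately show "card (mono_at G d D) \<le> card (mono_at G b D) + 0" by simp
  qed
  then show ?thesis by (intro exI[of _ d]) (auto simp: d_def)
qed

text \<open>Every vertex of \<open>Z\<close> is visited infinitely often, and at each visit a fresh
  neighbour is given the opposite colour.\<close>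

lemma greedy_colouring:
  fixes N :: "'a \<Rightarrow> 'a set"
  assumes Z: "countable Z" and inf: "\<And>z. z \<in> Z \<Longrightarrow> infinite (N z \<inter> Z)"
  shows "\<exists>c :: 'a \<Rightarrow> bool. \<forall>z\<in>Z. infinite {y \<in> N z \<inter> Z. c y \<noteq> c z}"
proof (cases "Z = {}")
  case False
  \<comment> \<open>Infinitely many pairs share a first component, so each member of
    \<open>Z\<close> occurs as \<open>zz n\<close> for infinitely many \<open>n\<close>.\<close>
  define zz where "zz n = from_nat_into Z (fst (prod_decode n))" for n
  have zz: "zz n \<in> Z" for n using False unfolding zz_def by (rule from_nat_into)
  \<comment> \<open>A state consists of the finite set of vertices whose colour is final and a
    colouring that is meaningful there.\<close>
  have "\<exists>s :: nat \<Rightarrow> 'a set \<times> ('a \<Rightarrow> bool). \<forall>n. finite (fst (s n)) \<and> (fst (s n) \<subseteq> fst (s (Suc n)) \<and>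
      (\<forall>v\<in>fst (s n). snd (s (Suc n)) v = snd (s n) v) \<and> zz n \<in> fst (s (Suc n)) \<and>
      (\<exists>y\<in>N (zz n) \<inter> Z. y \<notin> fst (s n) \<and> y \<in> fst (s (Suc n)) \<and>
         snd (s (Suc n)) y \<noteq> snd (s (Suc n)) (zz n)))"
  proof (rule dependent_nat_choice[where P="\<lambda>_ p. finite (fst p)" and
        Q="\<lambda>n p q. fst p \<subseteq> fst q \<and> (\<forall>v\<in>fst p. snd q v = snd p v) \<and> zz n \<in> fst q \<and>
          (\<exists>y\<in>N (zz n) \<inter> Z. y \<notin> fst p \<and> y \<in> fst q \<and> snd q y \<noteq> snd q (zz n))"])
    show "\<exists>p :: 'a set \<times> ('a \<Rightarrow> bool). finite (fst p)"
      by (rule exI[of _ "({}, \<lambda>_. False)"]) simp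
    fix p :: "'a set \<times> ('a \<Rightarrow> bool)" and n assume p: "finite (fst p)"
    let ?z = "zz n"
    have "infinite (N ?z \<inter> Z - insert ?z (fst p))" using inf[OF zz] p by auto
    then obtain y where "y \<in> N ?z \<inter> Z - insert ?z (fst p)" using infinite_imp_nonempty by blast
    then have y: "y \<in> N ?z \<inter> Z" "y \<noteq> ?z" "y \<notin> fst p" by auto
    \<comment> \<open>If \<open>?z\<close> is not yet coloured, its present default value becomes
      final.\<close>
    then show "\<exists>q. finite (fst q) \<and> fst p \<subseteq> fst q \<and> (\<forall>v\<in>fst p. snd q v = snd p v) \<and>
        ?z \<in> fst q \<and> (\<exists>y\<in>N ?z \<inter> Z. y \<notin> fst p \<and> y \<in> fst q \<and> snd q y \<noteq> snd q ?z)"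
      using p
      by (intro exI[of _ "(insert y (insert ?z (fst p)), (snd p)(y := \<not> snd p ?z))"]) auto
  qed
  then obtain s :: "nat \<Rightarrow> 'a set \<times> ('a \<Rightarrow> bool)" where
    s0: "\<forall>n. finite (fst (s n)) \<and> (fst (s n) \<subseteq> fst (s (Suc n)) \<and>
      (\<forall>v\<in>fst (s n). snd (s (Suc n)) v = snd (s n) v) \<and> zz n \<in> fst (s (Suc n)) \<and>
      (\<exists>y\<in>N (zz n) \<inter> Z. y \<notin> fst (s n) \<and> y \<in> fst (s (Suc n)) \<and>
         snd (s (Suc n)) y \<noteq> snd (s (Suc n)) (zz n)))" ..
  then have s: "\<And>n. fst (s n) \<subseteq> fst (s (Suc n))"
    "\<And>n v. v \<in> fst (s n) \<Longrightarrow> snd (s (Suc n)) v = snd (s n) v"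
    "\<And>n. zz n \<in> fst (s (Suc n))"
    by simp_all
  have "\<forall>n. \<exists>y. y \<in> N (zz n) \<inter> Z \<and> y \<notin> fst (s n) \<and> y \<in> fst (s (Suc n)) \<and>
         snd (s (Suc n)) y \<noteq> snd (s (Suc n)) (zz n)"
    using s0 by (simp add: Bex_def)
  from choice[OF this] obtain y where
    "\<forall>n. y n \<in> N (zz n) \<inter> Z \<and> y n \<notin> fst (s n) \<and> y n \<in> fst (s (Suc n)) \<and>
         snd (s (Suc n)) (y n) \<noteq> snd (s (Suc n)) (zz n)" ..
  then have y: "\<And>n. y n \<in> N (zz n) \<inter> Z" "\<And>n. y n \<notin> fst (s n)"
    "\<And>n. y n \<in> fst (s (Suc n))" "\<And>n. snd (s (Suc n)) (y n) \<noteq> snd (s (Suc n)) (zz n)"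
    by simp_all
  have mono: "fst (s m) \<subseteq> fst (s n)" if "m \<le> n" for m n
    using lift_Suc_mono_le[of "\<lambda>n. fst (s n)", OF s(1) that] .
  have stable: "snd (s n) v = snd (s m) v" if "m \<le> n" "v \<in> fst (s m)" for m n v
    using that(1)
  proof (induction n rule: dec_induct)
    case (step n)
    then show ?case using s(2)[of v n] mono[of m n] that(2) by auto
  qed simp
  define c where "c v = snd (s (LEAST k. v \<in> fst (s k))) v" for v
  have c: "c v = snd (s k) v" if "v \<in> fst (s k)" for v k
    unfolding c_def
    using stable[OF Least_le[of "\<lambda>k. v \<in> fst (s k)", OF that]
        LeastI[of "\<lambda>k. v \<in> fst (s k)", OF that]] by simp
  have "infinite {w \<in> N z \<inter> Z. c w \<noteq> c z}" if z: "z \<in> Z" for z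
  proof -
    let ?h = "\<lambda>i. prod_encode (to_nat_on Z z, i)"
    have hz: "zz (?h i) = z" for i using z Z unfolding zz_def by simp
    have "inj y"
    proof (rule linorder_injI)
      fix m n :: nat assume "m < n"
      then have "y m \<in> fst (s n)" using y(3)[of m] mono[of "Suc m" n] by auto
      then show "y m \<noteq> y n" using y(2)[of n] by auto
    qed
    then have "inj (\<lambda>i. y (?h i))" by (auto intro!: injI dest!: injD[of y])
    then have "infinite (range (\<lambda>i. y (?h i)))" using finite_imageD by blast
    moreover have "range (\<lambda>i. y (?h i)) \<subseteq> {w \<in> N z \<inter> Z. c w \<noteq> c z}"
    proof clarify
      fix i
      show "y (?h i) \<in> N z \<inter> Z \<and> c (y (?h i)) \<noteq> c z"
        using y(1,4)[of "?h i"] c[OF y(3)[of "?h i"]] c[OF s(3)[of "?h i"]] hz[of i] by simp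
    qed
    ultimately show ?thesis using finite_subset by blast
  qed
  then show ?thesis by blast
qed simp

lemma extend_infinitely_many_opponents:
  fixes N :: "'a \<Rightarrow> 'a set" and c :: "'a \<Rightarrow> bool"
  assumes K: "countable K" "K \<inter> U = {}" and inf: "\<And>k. k \<in> K \<Longrightarrow> infinite (N k \<inter> (U \<union> K))"
  shows "\<exists>c'. (\<forall>u\<in>U. c' u = c u) \<and> (\<forall>k\<in>K. infinite {y \<in> N k. c' y \<noteq> c' k})"
proof -
  \<comment> \<open>Zorn's lemma on partial colourings, as sets of pairs. A vertex outside the domain of a maximal
    one has only finitely many neighbours in the domain, so the greedy colouring applies to the rest.\<close>
  define \<A> :: "('a \<times> bool) set set" where "\<A> = {g. (\<forall>x. (x, True) \<in> g \<longrightarrow> (x, False) \<notin> g) \<and>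
     (\<forall>u\<in>U. (u, c u) \<in> g) \<and> (\<forall>(k, b)\<in>g. k \<in> U \<or> infinite {y \<in> N k. (y, \<not> b) \<in> g})}"
  have "(\<lambda>u. (u, c u)) ` U \<in> \<A>" unfolding \<A>_def by auto
  then have ne: "\<A> \<noteq> {}" by blast
  have "\<Union>\<G> \<in> \<A>" if "\<G> \<noteq> {}" and ch: "subset.chain \<A> \<G>" for \<G>
  proof -
    have sub: "\<G> \<subseteq> \<A>" and tot: "\<And>g h. g \<in> \<G> \<Longrightarrow> h \<in> \<G> \<Longrightarrow> g \<subseteq> h \<or> h \<subseteq> g"
      using ch unfolding subset.chain_def by auto
    have "(x, False) \<notin> \<Union>\<G>" if "(x, True) \<in> \<Union>\<G>" for x
    proof
      assume "(x, False) \<in> \<Union>\<G>"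
      then obtain g h where "g \<in> \<G>" "h \<in> \<G>" "(x, True) \<in> g" "(x, False) \<in> h" using \<open>(x, True) \<in> \<Union>\<G>\<close> by blast
      then obtain g' where "g' \<in> \<G>" "(x, True) \<in> g'" "(x, False) \<in> g'" using tot by blast
      then show False using sub unfolding \<A>_def by blast
    qed
    moreover have "\<forall>u\<in>U. (u, c u) \<in> \<Union>\<G>" using sub \<open>\<G> \<noteq> {}\<close> unfolding \<A>_def by blast
    moreover have "k \<in> U \<or> infinite {y \<in> N k. (y, \<not> b) \<in> \<Union>\<G>}" if "(k, b) \<in> \<Union>\<G>" for k b
    proof -
      obtain g where g: "g \<in> \<G>" "(k, b) \<in> g" using \<open>(k, b) \<in> \<Union>\<G>\<close> by blast
      then have "k \<in> U \<or> infinite {y \<in> N k. (y, \<not> b) \<in> g}" using sub unfolding \<A>_def by blast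
      moreover have "{y \<in> N k. (y, \<not> b) \<in> g} \<subseteq> {y \<in> N k. (y, \<not> b) \<in> \<Union>\<G>}" using g by blast
      ultimately show ?thesis using finite_subset by blast
    qed
    ultimately show ?thesis unfolding \<A>_def by blast
  qed
  then obtain g where g: "g \<in> \<A>" and max: "\<And>h. h \<in> \<A> \<Longrightarrow> g \<subseteq> h \<Longrightarrow> h = g"
    using subset_Zorn_nonempty[OF ne] by metis
  have sv: "\<And>x. (x, True) \<in> g \<Longrightarrow> (x, False) \<notin> g" and gU: "\<And>u. u \<in> U \<Longrightarrow> (u, c u) \<in> g"
    and gi: "\<And>k b. (k, b) \<in> g \<Longrightarrow> k \<in> U \<or> infinite {y \<in> N k. (y, \<not> b) \<in> g}"
    using g unfolding \<A>_def by blast+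
  let ?R = "K - Domain g"
  have "?R = {}"
  proof (rule ccontr)
    assume R: "?R \<noteq> {}"
    have fin: "finite (N k \<inter> Domain g)" if k: "k \<in> ?R" for k
    proof (rule ccontr)
      assume i: "infinite (N k \<inter> Domain g)"
      have "N k \<inter> Domain g \<subseteq> {y \<in> N k. (y, \<not> True) \<in> g} \<union> {y \<in> N k. (y, \<not> False) \<in> g}"
      proof
        fix y assume "y \<in> N k \<inter> Domain g"
        then obtain b where "y \<in> N k" "(y, b) \<in> g" by blast
        then show "y \<in> {y \<in> N k. (y, \<not> True) \<in> g} \<union> {y \<in> N k. (y, \<not> False) \<in> g}"
          by (cases b) auto
      qed
      then have "infinite ({y \<in> N k. (y, \<not> True) \<in> g} \<union> {y \<in> N k. (y, \<not> False) \<in> g})"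
        using i infinite_super by blast
      then obtain b where b: "infinite {y \<in> N k. (y, \<not> b) \<in> g}"
        unfolding finite_Un by blast
      \<comment> \<open>Infinitely many coloured neighbours of \<open>k\<close> share one colour;
        giving \<open>k\<close> the other colour \<open>b\<close> would extend the maximal
        \<open>g\<close>.\<close>
      have "insert (k, b) g \<in> \<A>"
        unfolding \<A>_def
      proof (intro CollectI conjI)
        show "\<forall>x. (x, True) \<in> insert (k, b) g \<longrightarrow> (x, False) \<notin> insert (k, b) g"
          using sv k by blast
        show "\<forall>u\<in>U. (u, c u) \<in> insert (k, b) g" using gU by blast
        show "\<forall>(j, a)\<in>insert (k, b) g. j \<in> U \<or> infinite {y \<in> N j. (y, \<not> a) \<in> insert (k, b) g}"
        proof (rule ballI, rule case_prodI2, hypsubst, rule disjCI)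
          fix j a assume ja: "(j, a) \<in> insert (k, b) g"
            and "\<not> infinite {y \<in> N j. (y, \<not> a) \<in> insert (k, b) g}"
          then have fi: "finite {y \<in> N j. (y, \<not> a) \<in> insert (k, b) g}" by blast
          have "finite {y \<in> N j. (y, \<not> a) \<in> g}"
            by (rule finite_subset[OF _ fi]) auto
          then show "j \<in> U" using ja gi[of j a] b by (cases "(j, a) \<in> g") auto
        qed
      qed
      then have "insert (k, b) g = g" using max by blast
      then show False using k by blast
    qed
    have "infinite (N k \<inter> ?R)" if k: "k \<in> ?R" for k
    proof
      assume "finite (N k \<inter> ?R)"
      moreover have "N k \<inter> (U \<union> K) \<subseteq> (N k \<inter> Domain g) \<union> (N k \<inter> ?R)" using gU by blast
      ultimately show False using fin[OF k] inf[of k] k finite_subset by blast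
    qed
    moreover have "countable ?R" using K(1) by simp
    ultimately obtain d :: "'a \<Rightarrow> bool" where d: "\<And>r. r \<in> ?R \<Longrightarrow> infinite {y \<in> N r \<inter> ?R. d y \<noteq> d r}"
      using greedy_colouring[of ?R N] by blast
    define h where "h = g \<union> (\<lambda>r. (r, d r)) ` ?R"
    have "h \<in> \<A>"
      unfolding \<A>_def
    proof (intro CollectI conjI)
      show "\<forall>x. (x, True) \<in> h \<longrightarrow> (x, False) \<notin> h" using sv unfolding h_def by auto
      show "\<forall>u\<in>U. (u, c u) \<in> h" using gU unfolding h_def by auto
      show "\<forall>(k, b)\<in>h. k \<in> U \<or> infinite {y \<in> N k. (y, \<not> b) \<in> h}"
      proof (rule ballI, rule case_prodI2, hypsubst, rule disjCI)
        fix k b assume kb: "(k, b) \<in> h" and "\<not> infinite {y \<in> N k. (y, \<not> b) \<in> h}"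
        then have fi: "finite {y \<in> N k. (y, \<not> b) \<in> h}" by blast
        show "k \<in> U"
        proof (cases "(k, b) \<in> g")
          case True
          have "finite {y \<in> N k. (y, \<not> b) \<in> g}"
            by (rule finite_subset[OF _ fi]) (auto simp: h_def)
          then show ?thesis using gi[OF True] by blast
        next
          case False
          then have k: "k \<in> ?R" "b = d k" using kb unfolding h_def by auto
          have "finite {y \<in> N k \<inter> ?R. d y \<noteq> d k}"
          proof (rule finite_subset[OF _ fi])
            show "{y \<in> N k \<inter> ?R. d y \<noteq> d k} \<subseteq> {y \<in> N k. (y, \<not> b) \<in> h}"
            proof
              fix y assume y: "y \<in> {y \<in> N k \<inter> ?R. d y \<noteq> d k}"
              then have "d y = (\<not> b)" using k by auto
              then show "y \<in> {y \<in> N k. (y, \<not> b) \<in> h}" using y unfolding h_def by force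
            qed
          qed
          then show ?thesis using d[OF k(1)] by blast
        qed
      qed
    qed
    then have "h = g" using max unfolding h_def by blast
    then show False using R unfolding h_def by blast
  qed
  then have KD: "K \<subseteq> Domain g" by blast
  define c' where "c' v = ((v, True) \<in> g)" for v
  have c': "c' v = b" if "(v, b) \<in> g" for v b
    using that sv[of v] unfolding c'_def by (cases b) auto
  have "infinite {y \<in> N k. c' y \<noteq> c' k}" if k: "k \<in> K" for k
  proof -
    obtain b where b: "(k, b) \<in> g" using KD k by blast
    then have "infinite {y \<in> N k. (y, \<not> b) \<in> g}" using gi k K(2) by blast
    moreover have "{y \<in> N k. (y, \<not> b) \<in> g} \<subseteq> {y \<in> N k. c' y \<noteq> c' k}"
      using c'[OF b] c' by auto
    ultimately show ?thesis using finite_subset by blast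
  qed
  then show ?thesis using c'[OF gU] by (intro exI[of _ c']) auto
qed

section \<open>The base class\<close>

lemma countable_card_of_le:
  assumes "countable A" "infinite B"
  shows "|A| \<le>o |B|"
proof -
  obtain f :: "'a \<Rightarrow> nat" where "inj_on f A" using assms(1) by (rule countableE)
  then have "|A| \<le>o |UNIV :: nat set|" using card_of_ordLeq[of A "UNIV :: nat set"] by blast
  moreover have "|UNIV :: nat set| \<le>o |B|" using assms(2) infinite_iff_card_of_nat by blast
  ultimately show ?thesis by (rule ordLeq_transitive)
qed

text \<open>In a countable graph the bound by an infinite \<open>|opp G c x|\<close> is automatic,
  so extending the flipped precolouring suffices.\<close>

lemma countable_flippable:
  assumes G: "is_graph G" and V: "countable (verts G)" and ex: "extendable G U"
  shows "flippable G U"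
proof (rule flippableI[OF G])
  fix c x assume x: "x \<in> U" and inf: "infinite (opp G c x)"
  obtain c' where c': "good G U c'" "\<forall>u\<in>U. c' u = (c(x := \<not> c x)) u"
    using ex unfolding extendable_def by blast
  have "countable (diff G c c')" using V unfolding diff_def by auto
  then have "|diff G c c'| \<le>o |opp G c x|" using inf by (rule countable_card_of_le)
  then show "\<exists>c'. good G U c' \<and> c' x = (\<not> c x) \<and> (\<forall>u\<in>U - {x}. c' u = c u) \<and> |diff G c c'| \<le>o |opp G c x|"
    using c' x by (intro exI[of _ c']) auto
qed

lemma base_W_extendable:
  fixes G :: "'a ugraph"
  assumes "G \<in> base_W"
  shows "extendable G U"
  unfolding extendable_def
proof
  fix c :: "'a \<Rightarrow> bool"
  have G: "is_graph G" and V: "countable (verts G)" and star: "finite (V_star G)"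
    using assms unfolding base_W_def by auto
  \<comment> \<open>The vertices to be coloured greedily. Finiteness of \<open>V_star G\<close>
    ensures that each has infinitely many neighbours in \<open>U \<union> K\<close>.\<close>
  define K where "K = V_inf G - V_star G - U"
  have KV: "K \<subseteq> verts G" unfolding K_def V_inf_def by auto
  have "infinite (nbrs G k \<inter> (U \<union> K))" if k: "k \<in> K" for k
  proof
    assume "finite (nbrs G k \<inter> (U \<union> K))"
    moreover have "nbrs G k \<inter> V_inf G \<subseteq> (nbrs G k \<inter> (U \<union> K)) \<union> V_star G" unfolding K_def by auto
    ultimately have "finite (nbrs G k \<inter> V_inf G)" using star finite_subset by blast
    then show False using k unfolding K_def V_star_def by auto
  qed
  moreover have "countable K" using V KV countable_subset by blast
  moreover have "K \<inter> U = {}" unfolding K_def by auto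
  ultimately obtain c1 where c1: "\<forall>u\<in>U. c1 u = c u"
    "\<forall>k\<in>K. infinite {y \<in> nbrs G k \<inter> (U \<union> K). c1 y \<noteq> c1 k}"
    using extend_infinitely_many_opponents[of K U "\<lambda>k. nbrs G k \<inter> (U \<union> K)" c] by auto
  \<comment> \<open>The remaining free vertices of infinite degree lie in \<open>V_star G\<close>.
    With them precoloured too, compactness is enough; \<open>uncolour_finite\<close> then releases
    them.\<close>
  let ?T = "V_inf G - (U \<union> K)"
  have T: "finite ?T" by (rule finite_subset[OF _ star]) (auto simp: K_def)
  have "extendable G (?T \<union> (U \<union> K))"
    unfolding extendable_def
  proof
    fix b
    let ?F = "fin_verts G - (?T \<union> (U \<union> K))"
    have "countable ?F" using V unfolding fin_verts_def by auto
    then obtain d where "\<forall>v. v \<notin> ?F \<longrightarrow> d v = b v" "near_min G ?F 0 d"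
      using locally_minimal_exists[OF G, of ?F b] by auto
    then show "\<exists>c'. good G (?T \<union> (U \<union> K)) c' \<and> (\<forall>u\<in>?T \<union> (U \<union> K). c' u = b u)"
      unfolding good_def by (intro exI[of _ d]) auto
  qed
  then have "extendable G (U \<union> K)"
    using uncolour_finite[OF G T _ _ countable_flippable[OF G V]] by blast
  then obtain c2 where c2: "good G (U \<union> K) c2" "\<forall>u\<in>U \<union> K. c2 u = c1 u"
    unfolding extendable_def by blast
  \<comment> \<open>Releasing \<open>K\<close> costs nothing: its vertices have infinitely many
    opponents in \<open>U \<union> K\<close>, where \<open>c2\<close> agrees with \<open>c1\<close>,
    and in a countable graph that is enough.\<close>
  have "|nbrs G x| \<le>o |opp G c2 x|" if x: "x \<in> V_inf G - U" for x
  proof (cases "x \<in> K")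
    case True
    have "{y \<in> nbrs G x \<inter> (U \<union> K). c1 y \<noteq> c1 x} \<subseteq> opp G c2 x"
      using c2(2) True unfolding opp_def by auto
    then have "infinite (opp G c2 x)" using c1(2) True finite_subset by blast
    moreover have "countable (nbrs G x)" using V unfolding nbrs_def by auto
    ultimately show ?thesis using countable_card_of_le by blast
  next
    case False
    then show ?thesis using c2(1) x unfolding good_def by blast
  qed
  moreover have "fin_verts G - (U \<union> K) = fin_verts G - U"
    unfolding K_def fin_verts_def V_inf_def by auto
  ultimately have "good G U c2" using c2(1) unfolding good_def by auto
  then show "\<exists>c'. good G U c' \<and> (\<forall>u\<in>U. c' u = c u)" using c1(1) c2(2) by auto
qed

section \<open>Induction on the rank\<close>

text \<open>Finitely many new vertices do not change which old vertices have infinite degree, so an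
  old vertex in \<open>V_star H\<close> is already in \<open>V_star G\<close>.\<close>

lemma base_W_finite_extension:
  assumes "G \<in> base_W" and H: "is_graph H" and sub: "verts G \<subseteq> verts H"
    and fin: "finite (verts H - verts G)" and ind: "induced H (verts G) = G"
  shows "H \<in> base_W"
proof -
  have V: "countable (verts G)" and star: "finite (V_star G)"
    using assms unfolding base_W_def by auto
  have nb: "nbrs G x = nbrs H x \<inter> verts G" if "x \<in> verts G" for x
    using nbrs_induced[OF sub that] ind by simp
  have inf: "x \<in> V_inf H \<longleftrightarrow> x \<in> V_inf G" if x: "x \<in> verts G" for x
  proof -
    have "nbrs H x = nbrs G x \<union> (nbrs H x \<inter> (verts H - verts G))"
      using nb[OF x] unfolding nbrs_def by auto
    then have "finite (nbrs H x) \<longleftrightarrow> finite (nbrs G x)"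
      using fin by (metis finite_Int finite_Un)
    then show ?thesis using x sub unfolding V_inf_def by auto
  qed
  have "V_star H \<subseteq> V_star G \<union> (verts H - verts G)"
  proof
    fix x assume x: "x \<in> V_star H"
    show "x \<in> V_star G \<union> (verts H - verts G)"
    proof (cases "x \<in> verts G")
      case True
      have "nbrs G x \<inter> V_inf G \<subseteq> nbrs H x \<inter> V_inf H"
        using nb[OF True] inf unfolding V_inf_def by auto
      then show ?thesis using x inf[OF True] finite_subset unfolding V_star_def by blast
    next
      case False
      then show ?thesis using x unfolding V_star_def V_inf_def by auto
    qed
  qed
  then have "finite (V_star H)" using star fin finite_subset by blast
  moreover have "verts H = verts G \<union> (verts H - verts G)" using sub by auto
  then have "countable (verts H)" using V fin countable_Un[of "verts G" "verts H - verts G"] by (simp add: countable_finite)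
  ultimately show ?thesis using H unfolding base_W_def by blast
qed

section \<open>Reachability and components\<close>

lemma reachable_refl: "reachable G x x"
  unfolding reachable_def by simp

lemma reachable_step: "reachable G x y \<Longrightarrow> {y, z} \<in> edges G \<Longrightarrow> reachable G x z"
  unfolding reachable_def by (auto intro: rtrancl_into_rtrancl)

lemma reachable_trans: "reachable G x y \<Longrightarrow> reachable G y z \<Longrightarrow> reachable G x z"
  unfolding reachable_def by (rule rtrancl_trans)

lemma reachable_sym: "reachable G x y \<Longrightarrow> reachable G y x"
proof -
  have "sym {(u, v). {u, v} \<in> edges G}" by (auto simp: sym_def insert_commute)
  then show "reachable G x y \<Longrightarrow> reachable G y x"
    unfolding reachable_def using sym_rtrancl symD by metis
qed

text \<open>The new vertices of \<open>H\<close> join the separator, so the pieces are still the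
  components of \<open>G\<close> without \<open>S\<close>.\<close>

lemma separation_components:
  assumes H: "is_graph H" and sub: "verts G \<subseteq> verts H" and fin: "finite (verts H - verts G)"
    and ind: "induced H (verts G) = G" and S: "finite S" "S \<subseteq> verts G"
  shows "separation H (S \<union> (verts H - verts G)) (verts ` components (remove_verts G S))"
proof
  let ?R = "remove_verts G S"
  have VR: "verts ?R = verts G - S" unfolding remove_verts_def by simp
  have "components ?R = (\<lambda>x. induced ?R {y \<in> verts G - S. reachable ?R x y}) ` (verts G - S)"
    unfolding components_def VR by (rule Setcompr_eq_image)
  then have comp: "K \<in> verts ` components ?R \<longleftrightarrow>
      (\<exists>x\<in>verts G - S. K = {y \<in> verts G - S. reachable ?R x y})" for K
    by (simp only: image_image verts_induced image_iff)
  show "is_graph H" "S \<union> (verts H - verts G) \<subseteq> verts H" "finite (S \<union> (verts H - verts G))"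
    using assms by auto
  show "\<Union> (verts ` components ?R) = verts H - (S \<union> (verts H - verts G))"
  proof
    show "\<Union> (verts ` components ?R) \<subseteq> verts H - (S \<union> (verts H - verts G))"
      using comp sub by blast
    show "verts H - (S \<union> (verts H - verts G)) \<subseteq> \<Union> (verts ` components ?R)"
    proof
      fix x assume "x \<in> verts H - (S \<union> (verts H - verts G))"
      then have x: "x \<in> verts G - S" by auto
      then have "{y \<in> verts G - S. reachable ?R x y} \<in> verts ` components ?R" using comp by blast
      then show "x \<in> \<Union> (verts ` components ?R)" using x reachable_refl[of ?R x] by blast
    qed
  qed
  show "C = C'" if C: "C \<in> verts ` components ?R" "C' \<in> verts ` components ?R" "v \<in> C" "v \<in> C'" for C C' v
  proof -
    have *: "K = {y \<in> verts G - S. reachable ?R v y}" if K: "K \<in> verts ` components ?R" and v: "v \<in> K" for K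
    proof -
      obtain x where x: "K = {y \<in> verts G - S. reachable ?R x y}" using K comp by blast
      then have "reachable ?R x v" using v by blast
      then show ?thesis unfolding x using reachable_trans[of ?R] reachable_sym[of ?R] by blast
    qed
    show ?thesis using *[of C] *[of C'] C by simp
  qed
  show "nbrs H v \<subseteq> C \<union> (S \<union> (verts H - verts G))" if C: "C \<in> verts ` components ?R" "v \<in> C" for C v
  proof
    fix y assume y: "y \<in> nbrs H v"
    obtain x where x: "C = {y \<in> verts G - S. reachable ?R x y}" using C comp by blast
    show "y \<in> C \<union> (S \<union> (verts H - verts G))"
    proof (rule ccontr)
      assume n: "y \<notin> C \<union> (S \<union> (verts H - verts G))"
      have yG: "y \<in> verts G - S" using n y unfolding nbrs_def by auto
      have vG: "v \<in> verts G - S" "reachable ?R x v" using C x by auto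
      have "{v, y} \<in> edges (induced H (verts G))"
        using y yG vG unfolding nbrs_def induced_def by auto
      then have "{v, y} \<in> edges G" unfolding ind .
      then have "{v, y} \<in> edges ?R"
        using yG vG(1) unfolding remove_verts_def induced_def by auto
      then have "reachable ?R x y" by (rule reachable_step[OF vG(2)])
      then show False using n yG x by auto
    qed
  qed
qed

text \<open>The finite extension \<open>H\<close> is what lets the induction hypothesis be applied to a component
  together with the separator.\<close>

lemma in_W_extendable_flippable:
  assumes "in_W \<mu> G"
  shows "is_graph H \<Longrightarrow> verts G \<subseteq> verts H \<Longrightarrow> finite (verts H - verts G) \<Longrightarrow>
    induced H (verts G) = G \<Longrightarrow> extendable H U \<and> flippable H U"
  using assms
proof (induction arbitrary: H U rule: in_W.induct)
  case (zero G)
  then have "H \<in> base_W" using base_W_finite_extension by blast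
  then show ?case
    using base_W_extendable countable_flippable unfolding base_W_def by blast
next
  case (pos \<mu> G S)
  let ?S = "S \<union> (verts H - verts G)" and ?R = "remove_verts G S"
  interpret separation H ?S "verts ` components ?R"
    using pos.prems pos.hyps by (intro separation_components) auto
  \<comment> \<open>Precolouring \<open>?T\<close> meets the assumption of
    \<open>extendable_flippable\<close> on separator vertices of infinite degree;
    \<open>uncolour_finite\<close> releases them afterwards.\<close>
  let ?T = "V_inf H \<inter> ?S"
  have parts: "extendable (part C) U' \<and> flippable (part C) U'"
    if C: "C \<in> verts ` components ?R" for C U'
  proof -
    obtain K where K: "K \<in> components ?R" "C = verts K" using C by blast
    have CR: "C \<subseteq> verts G - S" and Kind: "K = induced ?R C"
      using K unfolding components_def remove_verts_def by auto
    have "edges G = {e \<in> edges H. e \<subseteq> verts G}"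
      using arg_cong[OF pos.prems(4), of snd] unfolding induced_def by simp
    then have "induced (part C) C = K"
      using CR unfolding Kind remove_verts_def induced_def by auto
    moreover have "is_graph (part C)" using graph by (rule is_graph_induced)
    moreover have "finite (verts (part C) - C)"
      using finS by (rule finite_subset[rotated]) auto
    moreover have "verts K \<subseteq> verts (part C)" using K(2) by simp
    ultimately show ?thesis using bspec[OF pos.IH K(1)] unfolding K(2) by blast
  qed
  have "extendable H (?T \<union> U) \<and> flippable H (?T \<union> U)"
    using parts by (intro extendable_flippable) auto
  then show ?case
    using uncolour_finite[OF graph, of ?T U] finS by blast
qed

section \<open>From good colourings to unfriendly partitions\<close>

lemma card_le_card_of_le:
  assumes "finite A" "finite B" "card A \<le> card B"
  shows "|A| \<le>o |B|"
proof -
  obtain f where "f ` A \<subseteq> B" "inj_on f A" using card_le_inj[OF assms] by blast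
  then show ?thesis using card_of_ordLeq[of A B] by blast
qed

text \<open>At infinite degree the friends are at most as many as the neighbours, hence as the
  opponents. At finite degree \<open>locally_minimal_happy\<close> applies.\<close>

lemma extendable_pre_partitionable:
  assumes G: "is_graph G" and ex: "\<And>U. extendable G U"
  shows "pre_partitionable G"
  unfolding pre_partitionable_def
proof (intro allI impI; elim conjE)
  fix U and \<pi> :: "'a \<Rightarrow> nat"
  assume U: "U \<subseteq> verts G" and \<pi>: "is_partition U \<pi>"
  obtain c where c: "good G U c" and cU: "\<forall>u\<in>U. c u = (\<pi> u = 1)"
    using ex[of U] unfolding extendable_def by (elim allE[of _ "\<lambda>u. \<pi> u = 1"]) blast
  define \<pi>' :: "'a \<Rightarrow> nat" where "\<pi>' v = (if c v then 1 else 0)" for v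
  have op: "opponents G \<pi>' x = opp G c x" and fr: "friends G \<pi>' x = {y \<in> nbrs G x. c y = c x}" for x
    unfolding opponents_def friends_def opp_def \<pi>'_def by auto
  have "happy G \<pi>' x" if x: "x \<in> verts G - U" for x
  proof (cases "x \<in> V_inf G")
    case True
    then have "|nbrs G x| \<le>o |opp G c x|" using c x unfolding good_def by blast
    moreover have "|{y \<in> nbrs G x. c y = c x}| \<le>o |nbrs G x|" by (rule card_of_mono1) auto
    ultimately show ?thesis unfolding happy_def op fr using ordLeq_transitive by blast
  next
    case False
    then have x': "x \<in> fin_verts G" using x unfolding V_inf_def fin_verts_def by auto
    then have "card {y \<in> nbrs G x. c y = c x} \<le> card (opp G c x)"
      using c x unfolding good_def by (intro locally_minimal_happy[OF G, of "fin_verts G - U"]) auto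
    moreover have "finite {y \<in> nbrs G x. c y = c x}" "finite (opp G c x)"
      using x' unfolding fin_verts_def opp_def by auto
    ultimately show ?thesis unfolding happy_def op fr by (intro card_le_card_of_le)
  qed
  moreover have "is_partition (verts G) \<pi>'" unfolding is_partition_def \<pi>'_def by auto
  moreover have "\<forall>x\<in>U. \<pi>' x = \<pi> x"
    using cU \<pi> unfolding \<pi>'_def is_partition_def by auto
  ultimately show "\<exists>\<pi>'. is_partition (verts G) \<pi>' \<and> (\<forall>x\<in>U. \<pi>' x = \<pi> x) \<and>
      (\<forall>x\<in>verts G - U. happy G \<pi>' x)"
    by blast
qed

theorem theorem6:
  fixes G :: "'a ugraph"
  assumes "G \<in> W_bar TYPE('o)"
  shows "pre_partitionable G \<and> (\<exists>\<pi>. unfriendly G \<pi>)"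
proof -
  obtain \<mu> :: "'o rel" where \<mu>: "in_W \<mu> G" using assms unfolding W_bar_def by auto
  then have G: "is_graph G" by cases (auto simp: base_W_def)
  then have "induced G (verts G) = G" unfolding induced_def is_graph_def by (auto simp: prod_eq_iff)
  \<comment> \<open>The graph serves as its own finite extension, with \<open>H\<close> equal to
    \<open>G\<close>.\<close>
  then have "extendable G U" for U using in_W_extendable_flippable[OF \<mu> G] by auto
  with G have pp: "pre_partitionable G" by (rule extendable_pre_partitionable)
  \<comment> \<open>With nothing precoloured, every vertex has to be happy.\<close>
  moreover have "is_partition {} \<pi>" for \<pi> unfolding is_partition_def by auto
  ultimately have "\<exists>\<pi>. unfriendly G \<pi>"
    unfolding pre_partitionable_def unfriendly_def by (metis Diff_empty empty_subsetI)
  with pp show ?thesis by blast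
qed

end
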